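(* Let $0<\alpha<1$, $0<\beta<1$, and let $t>0$ be fixed. For positive integers $n$ let $h=t/n$. Then, as $n\to\infty$ (with $nh=t$), $$\frac{1}{h^\alpha}\sum_{k=0}^{n}(-1)^k\binom{\alpha}{k}(t-k h)^\beta=\frac{\Gamma(\beta+1)}{\Gamma(\beta-\alpha+1)}\left(t-\frac{\alpha h}{2}\right)^{\beta-\alpha}+\frac{ \zeta (-\beta)}{ \Gamma (-\alpha)\,t^{\alpha+1}}h^{\beta+1}+O(h^2).$$
   Context: $\zeta$ is the Riemann zeta function (analytically continued), and $\binom{\alpha}{k}=\frac{\alpha(\alpha-1)\cdots(\alpha-k+1)}{k!}$. *)

theory Defs
  imports "HOL-Complex_Analysis.Complex_Analysis" "HOL-Library.Landau_Symbols"
begin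

(* The library has no zeta function. By the identity theorem (the punctured plane is connected),
   the two conditions determine the function everywhere except at the pole 1, where its value is
   left unspecified. *)
definition riemann_zeta :: "complex \<Rightarrow> complex" where
  "riemann_zeta = (SOME f. f holomorphic_on (- {1}) \<and>
     (\<forall>s. Re s > 1 \<longrightarrow> (\<lambda>n. 1 / of_nat (Suc n) powr s) sums f s))"

end

theory Submission
  imports Defs "HOL-Real_Asymp.Real_Asymp"
begin

text \<open>
  After scaling by powers of \<open>h\<close> the sum is the convolution of \<open>w\<^sub>k = (-1)\<^sup>k (\<alpha> gchoose k)\<close>, the
  coefficients of \<open>(1 - z)\<^sup>\<alpha>\<close>, with \<open>m powr \<beta>\<close>. Up to a remainder \<open>r\<^sub>m = O(m powr (\<beta> - 3))\<close>, the
  sequence \<open>m powr \<beta>\<close> is a combination of the coefficients of \<open>(1 - z)\<^sup>-\<^sup>g\<close> for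
  \<open>g = \<beta> + 1, \<beta>, \<beta> - 1\<close>. Convolution with \<open>w\<close> maps these exactly to the coefficients for
  \<open>g - \<alpha>\<close>, whose asymptotics give the first term. The convolution of \<open>w\<close> with \<open>r\<close> is
  \<open>w\<^sub>n \<Sum>r\<close> up to the allowed error, and \<open>\<Sum>r\<close> is the constant term in the Euler-Maclaurin expansion
  of \<open>\<Sum>m powr \<beta>\<close>, i.e. \<open>\<zeta>(-\<beta>)\<close>.

  Summing the binomial expansion of \<open>(n + 1)\<^sup>1\<^sup>-\<^sup>s - n\<^sup>1\<^sup>-\<^sup>s\<close> expresses \<open>(s - 1) \<zeta>(s)\<close> through the values
  of \<open>\<zeta>\<close> at \<open>s + 1, s + 2, \<dots>\<close> and a locally uniformly convergent series, which continues
  \<open>\<zeta>\<close> strip by strip.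
\<close>

section \<open>Remainder of the binomial series\<close>

text \<open>Taylor's theorem at 1 along the segment from 1 to 2. The constant depends on
  \<open>a\<close> only through the bound \<open>A\<close>, so the estimate is uniform for exponents
  in a disc; holomorphy in \<open>s\<close> later relies on this.\<close>

lemma complex_powr_binomial_remainder:
  fixes a :: complex and x A :: real
  assumes "norm a \<le> A" and "0 \<le> x" and "x \<le> 1"
  shows "norm ((1 + of_real x) powr a - (\<Sum>j\<le>n. (a gchoose j) * of_real x ^ j))
           \<le> (A + real n) ^ Suc n * 2 powr A * x ^ Suc n"
proof -
  define S where "S = closed_segment (1::complex) 2"
  \<comment> \<open>\<open>F i\<close> is the \<open>i\<close>-th derivative of
    \<open>z powr a\<close>.\<close>
  define F where "F = (\<lambda>i z. (\<Prod>k<i. a - of_nat k) * z powr (a - of_nat i))"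
  have A0: "A \<ge> 0" using assms(1) norm_ge_zero order_trans by blast
  have S: "\<exists>u\<ge>1. u \<le> 2 \<and> z = of_real u" if "z \<in> S" for z
  proof -
    obtain u where u: "0 \<le> u" "u \<le> 1" "z = (1 - u) *\<^sub>R 1 + u *\<^sub>R 2"
      using \<open>z \<in> S\<close> unfolding S_def in_segment by blast
    then have "z = of_real (1 + u)" by (simp add: scaleR_conv_of_real algebra_simps)
    with u show ?thesis by (intro exI[of _ "1 + u"]) auto
  qed
  have "norm (F 0 (1 + of_real x) - (\<Sum>i\<le>n. F i 1 * ((1 + of_real x) - 1) ^ i / fact i))
     \<le> ((A + real n) ^ Suc n * 2 powr A) * norm ((1 + of_real x) - 1 :: complex) ^ Suc n / fact n"
  proof (rule complex_Taylor)
    show "convex S" by (simp add: S_def)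
    show "1 \<in> S" by (simp add: S_def)
    have "1 + of_real x = (1 - x) *\<^sub>R 1 + x *\<^sub>R (2::complex)"
      by (simp add: scaleR_conv_of_real algebra_simps)
    then show "1 + of_real x \<in> S"
      unfolding S_def in_segment using assms by blast
  next
    fix i z assume "z \<in> S"
    then obtain u where u: "u \<ge> 1" "z = of_real u" using S by blast
    then have "z \<notin> \<real>\<^sub>\<le>\<^sub>0" by (auto simp: complex_nonpos_Reals_iff)
    then show "(F i has_field_derivative F (Suc i) z) (at z within S)"
      unfolding F_def
      by (auto intro!: derivative_eq_intros has_field_derivative_powr simp: algebra_simps)
  next
    fix z assume "z \<in> S"
    then obtain u where u: "u \<ge> 1" "u \<le> 2" "z = of_real u" using S by blast
    have "Re a \<le> A" using assms(1) complex_Re_le_cmod order_trans by blast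
    have "norm (z powr (a - of_nat (Suc n))) = u powr (Re a - real (Suc n))"
      using u by (simp add: norm_powr_real_powr)
    also have "\<dots> \<le> u powr A"
      using u \<open>Re a \<le> A\<close> by (intro powr_mono) auto
    also have "\<dots> \<le> 2 powr A" using u A0 by (intro powr_mono2) auto
    finally have 1: "norm (z powr (a - of_nat (Suc n))) \<le> 2 powr A" .
    have "norm (\<Prod>k<Suc n. a - of_nat k) = (\<Prod>k<Suc n. norm (a - of_nat k))"
      by (simp add: prod_norm)
    also have "\<dots> \<le> (\<Prod>k<Suc n. A + real n)"
    proof (intro prod_mono conjI)
      fix k assume "k \<in> {..<Suc n}"
      have "norm (a - of_nat k) \<le> norm a + real k"
        using norm_triangle_ineq4[of a "of_nat k"] by simp
      with \<open>k \<in> _\<close> assms(1) show "norm (a - of_nat k) \<le> A + real n" by simp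
    qed auto
    also have "\<dots> = (A + real n) ^ Suc n" by simp
    finally have 2: "norm (\<Prod>k<Suc n. a - of_nat k) \<le> (A + real n) ^ Suc n" .
    show "norm (F (Suc n) z) \<le> (A + real n) ^ Suc n * 2 powr A"
      unfolding F_def norm_mult using 1 2 A0 by (intro mult_mono) auto
  qed
  moreover have "F i 1 * ((1 + of_real x) - 1) ^ i / fact i = (a gchoose i) * of_real x ^ i" for i
    by (simp add: F_def gbinomial_prod_rev atLeast0LessThan)
  moreover have "F 0 (1 + of_real x) = (1 + of_real x) powr a" by (simp add: F_def)
  ultimately have "norm ((1 + of_real x) powr a - (\<Sum>j\<le>n. (a gchoose j) * of_real x ^ j))
     \<le> ((A + real n) ^ Suc n * 2 powr A) * x ^ Suc n / fact n"
    using assms by simp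
  also have "\<dots> \<le> ((A + real n) ^ Suc n * 2 powr A) * x ^ Suc n"
  proof -
    have "c / fact n \<le> c" if "c \<ge> 0" for c :: real
      using mult_left_mono[OF fact_ge_1[of n] that] by (simp add: field_simps)
    then show ?thesis using A0 assms by simp
  qed
  finally show ?thesis .
qed

lemma real_powr_binomial_remainder:
  fixes a x :: real
  assumes "0 \<le> x" and "x \<le> 1"
  shows "\<bar>(1 + x) powr a - (\<Sum>j\<le>n. (a gchoose j) * x ^ j)\<bar>
           \<le> (\<bar>a\<bar> + real n) ^ Suc n * 2 powr \<bar>a\<bar> * x ^ Suc n"
proof -
  have "(1 + of_real x) powr of_real a - (\<Sum>j\<le>n. (of_real a gchoose j) * of_real x ^ j)
          = (of_real ((1 + x) powr a - (\<Sum>j\<le>n. (a gchoose j) * x ^ j)) :: complex)"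
    using assms powr_of_real[of "1 + x" a] by (simp add: gbinomial_prod_rev)
  then show ?thesis
    using complex_powr_binomial_remainder[of "of_real a" "\<bar>a\<bar>" x n] assms
    by (metis norm_of_real order_refl)
qed

lemma one_plus_inverse_powr_expansion:
  fixes a :: real
  shows "(\<lambda>n. (1 + 1 / real n) powr a - (\<Sum>j\<le>J. (a gchoose j) * (1 / real n) ^ j))
           \<in> O(\<lambda>n. 1 / real n ^ Suc J)"
proof (rule bigoI)
  show "\<forall>\<^sub>F n in sequentially.
          norm ((1 + 1 / real n) powr a - (\<Sum>j\<le>J. (a gchoose j) * (1 / real n) ^ j))
            \<le> ((\<bar>a\<bar> + real J) ^ Suc J * 2 powr \<bar>a\<bar>) * norm (1 / real n ^ Suc J)"
    using eventually_gt_at_top[of 0]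
  proof eventually_elim
    case (elim n)
    then show ?case
      using real_powr_binomial_remainder[of "1 / real n" a J] by (simp add: power_one_over)
  qed
qed

section \<open>Analytic continuation of the zeta function\<close>

text \<open>The Weierstrass M-test on small closed discs makes the partial sums converge locally
  uniformly, and such limits of holomorphic functions are holomorphic.\<close>

lemma holomorphic_on_suminf_locally_dominated:
  fixes f :: "nat \<Rightarrow> complex \<Rightarrow> complex"
  assumes "open U" and hol: "\<And>n. f n holomorphic_on U"
    and dom: "\<And>z. z \<in> U \<Longrightarrow> \<exists>d M. d > 0 \<and> cball z d \<subseteq> U \<and> summable M \<and> (\<forall>n. \<forall>w\<in>cball z d. norm (f n w) \<le> M n)"
  shows "(\<lambda>z. \<Sum>n. f n z) holomorphic_on U"
proof (rule holomorphic_uniform_sequence[where f = "\<lambda>N z. \<Sum>n<N. f n z", OF \<open>open U\<close>])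
  show "(\<lambda>z. \<Sum>n<N. f n z) holomorphic_on U" for N
    by (intro holomorphic_on_sum hol)
  fix z assume "z \<in> U"
  then obtain d M where d: "d > 0" "cball z d \<subseteq> U" "summable M" "\<And>n w. w \<in> cball z d \<Longrightarrow> norm (f n w) \<le> M n"
    using dom by metis
  have "uniform_limit (cball z d) (\<lambda>N z. \<Sum>n<N. f n z) (\<lambda>z. \<Sum>n. f n z) sequentially"
    by (rule Weierstrass_m_test[OF d(4) d(3)])
  then show "\<exists>d>0. cball z d \<subseteq> U \<and> uniform_limit (cball z d) (\<lambda>N z. \<Sum>n<N. f n z) (\<lambda>z. \<Sum>n. f n z) sequentially"
    using d by blast
qed

section \<open>The Dirichlet series in its half-plane of convergence\<close>

lemma norm_of_nat_Suc_powr: "norm ((of_nat (Suc n) :: complex) powr s) = real (Suc n) powr Re s"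
  using norm_powr_real_powr[of "of_nat (Suc n)" s] by simp

lemma summable_Suc_powr: "e < -1 \<Longrightarrow> summable (\<lambda>n. real (Suc n) powr e)"
  using summable_Suc_iff[of "\<lambda>n. real n powr e"] by (simp add: summable_real_powr_iff)

text \<open>A concrete stand-in for zeta, meaningful only for \<open>Re s > 1\<close>. It serves
  until \<open>riemann_zeta\<close>, defined by choice, is known to satisfy its defining
  conditions.\<close>

definition zeta_series :: "complex \<Rightarrow> complex" where
  "zeta_series s = (\<Sum>n. of_nat (Suc n) powr (-s))"

lemma zeta_series_sums:
  assumes "Re s > 1"
  shows "(\<lambda>n. of_nat (Suc n) powr (-s)) sums zeta_series s"
proof -
  have "summable (\<lambda>n. of_nat (Suc n) powr (-s) :: complex)"
    by (rule summable_norm_cancel) (use assms summable_Suc_powr[of "- Re s"] in \<open>simp add: norm_of_nat_Suc_powr del: of_nat_Suc\<close>)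
  then show ?thesis unfolding zeta_series_def by (rule summable_sums)
qed

lemma holomorphic_zeta_series: "zeta_series holomorphic_on {s. Re s > 1}"
  unfolding zeta_series_def
proof (rule holomorphic_on_suminf_locally_dominated)
  fix z :: complex assume z: "z \<in> {s. Re s > 1}"
  define d where "d = (Re z - 1) / 2"
  have Re_w: "Re w \<ge> 1 + d" if "w \<in> cball z d" for w
  proof -
    have "Re z - Re w \<le> d" using that complex_Re_le_cmod[of "z - w"] by (simp add: dist_norm)
    then show ?thesis by (simp add: d_def field_simps)
  qed
  show "\<exists>d M. d > 0 \<and> cball z d \<subseteq> {s. Re s > 1} \<and> summable M
      \<and> (\<forall>n. \<forall>w\<in>cball z d. norm (of_nat (Suc n) powr (-w) :: complex) \<le> M n)"
  proof (intro exI conjI allI ballI)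
    show "d > 0" using z by (simp add: d_def)
    then show "cball z d \<subseteq> {s. Re s > 1}" using Re_w by fastforce
    show "summable (\<lambda>n. real (Suc n) powr (-1-d))" by (rule summable_Suc_powr) (use \<open>d > 0\<close> in simp)
    show "norm (of_nat (Suc n) powr (-w) :: complex) \<le> real (Suc n) powr (-1-d)" if "w \<in> cball z d" for n w
      unfolding norm_of_nat_Suc_powr using Re_w[OF that] by (intro powr_mono) auto
  qed
qed (auto intro!: holomorphic_intros open_halfspace_Re_gt)

text \<open>The error of the order-\<open>J\<close> binomial expansion of \<open>(N + 1)\<^sup>1\<^sup>-\<^sup>s\<close> in
  descending powers of \<open>N = n + 1\<close>.\<close>

definition binomial_defect :: "nat \<Rightarrow> nat \<Rightarrow> complex \<Rightarrow> complex" where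
  "binomial_defect J n s = of_nat (Suc (Suc n)) powr (1 - s)
     - (\<Sum>j\<le>J. ((1 - s) gchoose j) * of_nat (Suc n) powr (1 - s - of_nat j))"

section \<open>Bounds and sums of the binomial defects\<close>

lemma binomial_defect_1:
  "binomial_defect 1 n s = of_nat (Suc (Suc n)) powr (1 - s) - of_nat (Suc n) powr (1 - s)
     - (1 - s) * of_nat (Suc n) powr (- s)"
proof -
  have e: "1 - s - of_nat 0 = 1 - s" "1 - s - of_nat (Suc 0) = - s"
    by simp_all
  show ?thesis
    unfolding binomial_defect_def One_nat_def sum.atMost_Suc atMost_0 e by (simp del: of_nat_Suc add: e)
qed

lemma binomial_defect_2:
  "binomial_defect 2 n s = of_nat (Suc (Suc n)) powr (1 - s) - of_nat (Suc n) powr (1 - s)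
     - (1 - s) * of_nat (Suc n) powr (- s) + (1 - s) * s / 2 * of_nat (Suc n) powr (- s - 1)"
proof -
  have e: "1 - s - of_nat 0 = 1 - s" "1 - s - of_nat (Suc 0) = - s" "1 - s - of_nat (Suc (Suc 0)) = - s - 1"
    by simp_all
  have g: "((1 - s) gchoose Suc (Suc 0)) = - ((1 - s) * s / 2)"
    by (simp add: gbinomial_Suc numeral_2_eq_2)
  show ?thesis
    unfolding binomial_defect_def numeral_2_eq_2 sum.atMost_Suc atMost_0 e g by (simp del: of_nat_Suc add: e)
qed

text \<open>With \<open>N = n + 1\<close> and \<open>x = 1 / N\<close>, the factor
  \<open>N powr (1 - s)\<close> splits off from every term and leaves the binomial remainder of
  \<open>(1 + x) powr (1 - s)\<close>, which contributes \<open>J + 1\<close> further powers of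
  \<open>1 / N\<close>.\<close>

lemma norm_binomial_defect_le:
  assumes "norm (1 - s) \<le> A"
  shows "norm (binomial_defect J n s) \<le> (A + real J) ^ Suc J * 2 powr A * real (Suc n) powr (- Re s - real J)"
proof -
  define N where "N = (of_nat (Suc n) :: complex)"
  define x where "x = 1 / real (Suc n)"
  have x: "0 \<le> x" "x \<le> 1" by (auto simp: x_def)
  have "of_nat (Suc (Suc n)) = N * (1 + of_real x)"
    by (simp add: N_def x_def field_simps del: of_nat_Suc) (simp add: algebra_simps)
  then have "of_nat (Suc (Suc n)) powr (1 - s) = N powr (1 - s) * (1 + of_real x) powr (1 - s)"
    using x powr_times_real[of N "1 + of_real x"] by (simp add: N_def)
  moreover have "N powr (1 - s - of_nat j) = N powr (1 - s) * of_real x ^ j" for j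
  proof -
    have "N \<noteq> 0" unfolding N_def using of_nat_neq_0 by blast
    moreover have "of_real x = 1 / N" by (simp add: x_def N_def)
    ultimately show ?thesis by (simp add: powr_diff power_divide)
  qed
  ultimately have "binomial_defect J n s = N powr (1 - s) * ((1 + of_real x) powr (1 - s) - (\<Sum>j\<le>J. ((1 - s) gchoose j) * of_real x ^ j))"
    unfolding binomial_defect_def N_def[symmetric]
    by (simp add: right_diff_distrib sum_distrib_left mult_ac)
  then have "norm (binomial_defect J n s) \<le> real (Suc n) powr (1 - Re s) * ((A + real J) ^ Suc J * 2 powr A * x ^ Suc J)"
    using complex_powr_binomial_remainder[OF assms x, of J]
    by (simp add: norm_mult N_def norm_of_nat_Suc_powr mult_left_mono del: of_nat_Suc power_Suc)
  also have "x ^ Suc J = real (Suc n) powr (- real (Suc J))"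
    unfolding x_def powr_minus by (subst powr_realpow) (simp_all add: power_one_over field_simps)
  also have "real (Suc n) powr (1 - Re s) * ((A + real J) ^ Suc J * 2 powr A * real (Suc n) powr (- real (Suc J)))
     = (A + real J) ^ Suc J * 2 powr A * (real (Suc n) powr (1 - Re s) * real (Suc n) powr (- real (Suc J)))"
    by simp
  also have "real (Suc n) powr (1 - Re s) * real (Suc n) powr (- real (Suc J)) = real (Suc n) powr (- Re s - real J)"
    by (subst powr_add[symmetric]) (simp add: algebra_simps)
  finally show ?thesis .
qed

text \<open>The exponent \<open>- Re s - J\<close> lies below -1 when \<open>Re s > 1 - J\<close>.
  Taking as radius half the distance to the boundary line keeps it below \<open>-1 - d\<close> on
  the whole disc, while \<open>A\<close> bounds \<open>norm (1 - w)\<close> there.\<close>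

lemma binomial_defect_dominated:
  assumes "Re z > 1 - real J"
  shows "\<exists>d M. d > 0 \<and> cball z d \<subseteq> {s. Re s > 1 - real J} \<and> summable M
      \<and> (\<forall>n. \<forall>w\<in>cball z d. norm (binomial_defect J n w) \<le> M n)"
proof (intro exI conjI allI ballI)
  define d where "d = (Re z - (1 - real J)) / 2"
  define A where "A = norm (1 - z) + d"
  have Re_w: "Re w \<ge> 1 - real J + d" if "w \<in> cball z d" for w
  proof -
    have "Re z - Re w \<le> d" using that complex_Re_le_cmod[of "z - w"] by (simp add: dist_norm)
    then show ?thesis by (simp add: d_def field_simps)
  qed
  show "d > 0" using assms by (simp add: d_def)
  then show "cball z d \<subseteq> {s. Re s > 1 - real J}" using Re_w by fastforce
  show "summable (\<lambda>n. (A + real J) ^ Suc J * 2 powr A * real (Suc n) powr (-1-d))"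
    by (intro summable_mult summable_Suc_powr) (use \<open>d > 0\<close> in simp)
  fix n w assume w: "w \<in> cball z d"
  have "norm (1 - w) \<le> A"
    using w norm_triangle_ineq[of "1 - z" "z - w"] by (simp add: A_def dist_norm)
  then have "norm (binomial_defect J n w) \<le> (A + real J) ^ Suc J * 2 powr A * real (Suc n) powr (- Re w - real J)"
    by (rule norm_binomial_defect_le)
  also have "\<dots> \<le> (A + real J) ^ Suc J * 2 powr A * real (Suc n) powr (-1-d)"
    using Re_w[OF w] \<open>d > 0\<close> by (intro mult_left_mono powr_mono) (auto simp: A_def)
  finally show "norm (binomial_defect J n w) \<le> (A + real J) ^ Suc J * 2 powr A * real (Suc n) powr (-1-d)" .
qed

definition defect_sum :: "nat \<Rightarrow> complex \<Rightarrow> complex" where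
  "defect_sum J s = (\<Sum>n. binomial_defect J n s)"

lemma holomorphic_defect_sum: "defect_sum J holomorphic_on {s. Re s > 1 - real J}"
  unfolding defect_sum_def
proof (rule holomorphic_on_suminf_locally_dominated)
  show "(\<lambda>s. binomial_defect J n s) holomorphic_on {s. Re s > 1 - real J}" for n
    unfolding binomial_defect_def gbinomial_prod_rev by (auto intro!: holomorphic_intros)
qed (use binomial_defect_dominated open_halfspace_Re_gt in auto)

lemma defect_sum_sums:
  assumes "Re s > 1 - real J"
  shows "(\<lambda>n. binomial_defect J n s) sums defect_sum J s"
proof -
  obtain d M where d: "d > 0" "summable M" "\<forall>n. \<forall>w\<in>cball s d. norm (binomial_defect J n w) \<le> M n"
    using binomial_defect_dominated[OF assms] by blast
  have "summable (\<lambda>n. binomial_defect J n s)"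
    by (rule summable_comparison_test'[OF d(2)]) (use d in auto)
  then show ?thesis unfolding defect_sum_def by (rule summable_sums)
qed

text \<open>Both sides evaluate the telescoping sum of
  \<open>(n + 2) powr (1 - s) - (n + 1) powr (1 - s)\<close>, which is -1 because the powers tend to
  0. The binomial term of index 0 cancels the subtracted power, hence the shift to
  \<open>Suc j\<close> and to order \<open>Suc J\<close>.\<close>

lemma zeta_series_defect_identity:
  assumes s: "Re s > 1"
  shows "(\<Sum>j\<le>J. ((1 - s) gchoose Suc j) * zeta_series (s + of_nat j)) + defect_sum (Suc J) s = -1"
proof -
  define f where "f = (\<lambda>n. of_nat (Suc n) powr (1 - s) :: complex)"
  have "f \<longlonglongrightarrow> 0"
  proof (rule Lim_null_comparison)
    show "\<forall>\<^sub>F n in sequentially. norm (f n) \<le> real (Suc n) powr (1 - Re s)"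
      by (auto simp: f_def norm_of_nat_Suc_powr simp del: of_nat_Suc)
    show "(\<lambda>n. real (Suc n) powr (1 - Re s)) \<longlonglongrightarrow> 0"
      using s by real_asymp
  qed
  then have 1: "(\<lambda>n. f (Suc n) - f n) sums (0 - f 0)" by (rule telescope_sums)
  have 2: "(\<lambda>n. (\<Sum>j\<le>J. ((1 - s) gchoose Suc j) * of_nat (Suc n) powr (- (s + of_nat j))) + binomial_defect (Suc J) n s)
     sums ((\<Sum>j\<le>J. ((1 - s) gchoose Suc j) * zeta_series (s + of_nat j)) + defect_sum (Suc J) s)"
    using s by (intro sums_add sums_sum sums_mult zeta_series_sums defect_sum_sums) auto
  have "(\<Sum>j\<le>J. ((1 - s) gchoose Suc j) * of_nat (Suc n) powr (- (s + of_nat j))) + binomial_defect (Suc J) n s = f (Suc n) - f n" for n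
    unfolding binomial_defect_def f_def
    by (subst sum.atMost_Suc_shift) (simp add: algebra_simps)
  with 1 2 have "(\<Sum>j\<le>J. ((1 - s) gchoose Suc j) * zeta_series (s + of_nat j)) + defect_sum (Suc J) s = 0 - f 0"
    by (simp add: sums_unique2)
  then show ?thesis by (simp add: f_def)
qed

text \<open>Continuing \<open>(s - 1) * zeta_series s\<close> instead of zeta itself leaves no pole
  to avoid. On the next strip the identity above is solved for this product; it then involves only
  points shifted right by at least 1, where the previous \<open>Z\<close> is holomorphic.\<close>

lemma zeta_series_continuation_halfplane:
  "\<exists>Z. Z holomorphic_on {s. Re s > 1 - real m} \<and> (\<forall>s. Re s > 1 \<longrightarrow> Z s = (s - 1) * zeta_series s)"
proof (induction m)
  case 0
  show ?case
    by (rule exI[of _ "\<lambda>s. (s - 1) * zeta_series s"]) (auto intro!: holomorphic_intros holomorphic_zeta_series)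
next
  case (Suc m)
  then obtain Z where Z: "Z holomorphic_on {s. Re s > 1 - real m}" "\<And>s. Re s > 1 \<Longrightarrow> Z s = (s - 1) * zeta_series s"
    by blast
  \<comment> \<open>The factor \<open>1 - s - (j + 1)\<close> of the binomial coefficient of index \<open>j + 2\<close> cancels the pole of
    the zeta function at \<open>s + j + 1 = 1\<close>, leaving \<open>Z\<close>.\<close>
  define Y where "Y = (\<lambda>s. 1 + defect_sum (Suc m) s
      - (\<Sum>j<m. ((1 - s) gchoose Suc j) / of_nat (Suc (Suc j)) * Z (s + of_nat (Suc j))))"
  have "Y holomorphic_on {s. Re s > 1 - real (Suc m)}"
  proof -
    have "(\<lambda>s. Z (s + of_nat (Suc j))) holomorphic_on {s. Re s > 1 - real (Suc m)}" for j
      by (rule holomorphic_on_compose_gen[OF _ Z(1), of "\<lambda>s. s + of_nat (Suc j)", unfolded o_def])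
         (auto intro!: holomorphic_intros)
    then show ?thesis
      unfolding Y_def gbinomial_prod_rev by (auto intro!: holomorphic_intros holomorphic_defect_sum simp del: of_nat_Suc)
  qed
  moreover have "Y s = (s - 1) * zeta_series s" if s: "Re s > 1" for s
  proof -
    have "((1 - s) gchoose Suc (Suc j)) * zeta_series (s + of_nat (Suc j))
       = - (((1 - s) gchoose Suc j) / of_nat (Suc (Suc j)) * Z (s + of_nat (Suc j)))" for j
    proof -
      have "Z (s + of_nat (Suc j)) = (s + of_nat (Suc j) - 1) * zeta_series (s + of_nat (Suc j))"
        using s by (intro Z) simp
      moreover have "((1 - s) gchoose Suc (Suc j)) = ((1 - s) gchoose Suc j) * (1 - s - of_nat (Suc j)) / of_nat (Suc (Suc j))"
        by (subst gbinomial_Suc) (simp add: gbinomial_Suc)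
      moreover have "1 - s - of_nat (Suc j) = - (s + of_nat (Suc j) - 1)" by simp
      ultimately show ?thesis by (simp only: mult_minus_right mult_minus_left divide_minus_left times_divide_eq_left times_divide_eq_right mult_ac)
    qed
    then have a: "(\<Sum>j<m. ((1 - s) gchoose Suc j) / of_nat (Suc (Suc j)) * Z (s + of_nat (Suc j)))
       = - (\<Sum>j<m. ((1 - s) gchoose Suc (Suc j)) * zeta_series (s + of_nat (Suc j)))"
      by (simp add: sum_negf del: of_nat_Suc)
    have b: "(\<Sum>j\<le>m. ((1 - s) gchoose Suc j) * zeta_series (s + of_nat j))
       = (1 - s) * zeta_series s + (\<Sum>j<m. ((1 - s) gchoose Suc (Suc j)) * zeta_series (s + of_nat (Suc j)))"
      unfolding lessThan_Suc_atMost[symmetric] by (subst sum.lessThan_Suc_shift) (simp del: of_nat_Suc)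
    define S where "S = (\<Sum>j<m. ((1 - s) gchoose Suc (Suc j)) * zeta_series (s + of_nat (Suc j)))"
    have c: "(1 - s) * zeta_series s + S + defect_sum (Suc m) s = -1"
      using zeta_series_defect_identity[OF s, of m] unfolding b S_def .
    have "Y s = ((1 - s) * zeta_series s + S + defect_sum (Suc m) s) + 1 + (s - 1) * zeta_series s"
      unfolding Y_def a S_def[symmetric] by (simp add: algebra_simps)
    then show ?thesis unfolding c by simp
  qed
  ultimately show ?case by blast
qed

text \<open>The half-planes exhaust the plane, and by the identity theorem continuations to two of
  them agree on the smaller one, so they glue to an entire function.\<close>

lemma zeta_series_continuation:
  "\<exists>Z. Z holomorphic_on UNIV \<and> (\<forall>s. Re s > 1 \<longrightarrow> Z s = (s - 1) * zeta_series s)"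
proof -
  define H where "H = (\<lambda>m::nat. {s::complex. Re s > 1 - real m})"
  obtain Z where Z: "\<And>m. Z m holomorphic_on H m" "\<And>m s. Re s > 1 \<Longrightarrow> Z m s = (s - 1) * zeta_series s"
    using zeta_series_continuation_halfplane unfolding H_def by metis
  have op: "open (H m)" for m unfolding H_def by (rule open_halfspace_Re_gt)
  have agree: "Z m s = Z k s" if "s \<in> H m" "s \<in> H k" for m k s
  proof -
    have *: "Z m s = Z k s" if "m \<le> k" "s \<in> H m" for m k s
    proof (rule analytic_continuation_open[of "{s. Re s > 1}" "H m" "Z m" "Z k"])
      show "connected (H m)" unfolding H_def by (intro convex_connected convex_halfspace_Re_gt)
      have "(2::complex) \<in> {s. Re s > 1}" by simp
      then show "{s::complex. Re s > 1} \<noteq> {}" by blast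
      show "Z k holomorphic_on H m"
        by (rule holomorphic_on_subset[OF Z(1)]) (use that in \<open>auto simp: H_def\<close>)
      show "{s. Re s > 1} \<subseteq> H m" by (auto simp: H_def)
      show "Z m z = Z k z" if "z \<in> {s. Re s > 1}" for z
        using that by (simp add: Z(2))
    qed (fact op Z(1) open_halfspace_Re_gt that)+
    then show ?thesis using that by (metis linear)
  qed
  \<comment> \<open>Some half-plane containing \<open>s\<close>; the 2 in place of 1 secures the
    strict inequality. By \<open>agree\<close> the choice does not affect the value.\<close>
  define m where "m = (\<lambda>s::complex. nat \<lceil>2 - Re s\<rceil>)"
  have m: "s \<in> H (m s)" for s
  proof -
    have "real (m s) \<ge> 2 - Re s" unfolding m_def by linarith
    then show ?thesis by (simp add: H_def)
  qed
  have "(\<lambda>s. Z (m s) s) holomorphic_on H k" for k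
    using Z(1)[of k] by (rule holomorphic_transform) (use agree m in blast)
  then have "(\<lambda>s. Z (m s) s) holomorphic_on (\<Union>k. H k)"
    by (intro holomorphic_on_UN_open op)
  moreover have "(\<Union>k. H k) = UNIV" using m by blast
  ultimately have "(\<lambda>s. Z (m s) s) holomorphic_on UNIV" by simp
  moreover have "\<forall>s. Re s > 1 \<longrightarrow> Z (m s) s = (s - 1) * zeta_series s" using Z(2) by blast
  ultimately show ?thesis by (intro exI[of _ "\<lambda>s. Z (m s) s"] conjI)
qed

section \<open>The zeta function and its values at negative arguments\<close>

lemma riemann_zeta_properties:
  shows holomorphic_riemann_zeta: "riemann_zeta holomorphic_on (- {1})"
    and riemann_zeta_eq_series: "Re s > 1 \<Longrightarrow> riemann_zeta s = zeta_series s"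
proof -
  obtain Z where Z: "Z holomorphic_on UNIV" "\<And>s. Re s > 1 \<Longrightarrow> Z s = (s - 1) * zeta_series s"
    using zeta_series_continuation by blast
  define f where "f = (\<lambda>s. Z s / (s - 1))"
  have terms: "1 / of_nat (Suc n) powr s = of_nat (Suc n) powr (-s)" for n and s :: complex
    by (simp add: powr_minus_divide)
  \<comment> \<open>The choice operator yields nothing before a witness exists; here it is the
    entire continuation divided by \<open>s - 1\<close>.\<close>
  have "\<exists>f. f holomorphic_on (- {1}) \<and> (\<forall>s. Re s > 1 \<longrightarrow> (\<lambda>n. 1 / of_nat (Suc n) powr s) sums f s)"
  proof (intro exI[of _ f] conjI allI impI)
    show "f holomorphic_on - {1}"
      unfolding f_def by (intro holomorphic_intros holomorphic_on_subset[OF Z(1)]) auto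
    fix s :: complex assume s: "Re s > 1"
    then have "f s = zeta_series s" using Z(2)[OF s] by (auto simp: f_def)
    then show "(\<lambda>n. 1 / of_nat (Suc n) powr s) sums f s"
      unfolding terms using zeta_series_sums[OF s] by simp
  qed
  from someI_ex[OF this, folded riemann_zeta_def]
  have *: "riemann_zeta holomorphic_on (- {1})" "\<And>s. Re s > 1 \<Longrightarrow> (\<lambda>n. 1 / of_nat (Suc n) powr s) sums riemann_zeta s"
    by blast+
  show "riemann_zeta holomorphic_on (- {1})" by fact
  show "riemann_zeta s = zeta_series s" if "Re s > 1"
    using *(2)[OF that] zeta_series_sums[OF that] unfolding terms by (rule sums_unique2)
qed

text \<open>For \<open>Re s > 1\<close>, the order-1 identity at \<open>s + 1\<close> and the
  order-2 identity at \<open>s\<close> both contain zeta at \<open>s + 1\<close>; eliminating it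
  gives the formula. Both defect sums are holomorphic for \<open>Re s > -1\<close>, so the identity
  theorem carries it to the strip containing -\<beta>.\<close>

lemma riemann_zeta_strip:
  assumes "Re s > -1" and "s \<noteq> 1"
  shows "(1 - s) * riemann_zeta s = (1 - s) / 2 * defect_sum 1 (s + 1) - defect_sum 2 s + (1 - s) / 2 - 1"
proof (rule analytic_continuation_open[of "{s. Re s > 1}" "{s. Re s > -1} - {1}"
     "\<lambda>s. (1 - s) * riemann_zeta s" "\<lambda>s. (1 - s) / 2 * defect_sum 1 (s + 1) - defect_sum 2 s + (1 - s) / 2 - 1"])
  have op: "open {s. Re s > -1}" by (rule open_halfspace_Re_gt)
  then show "open ({s. Re s > -1} - {1})" by blast
  show "connected ({s. Re s > -1} - {1::complex})"
    by (intro connected_open_delete op convex_connected convex_halfspace_Re_gt) simp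
  have "(2::complex) \<in> {s. Re s > 1}" by simp
  then show "{s::complex. Re s > 1} \<noteq> {}" by blast
  show "(\<lambda>s. (1 - s) * riemann_zeta s) holomorphic_on {s. Re s > -1} - {1}"
    by (intro holomorphic_intros holomorphic_on_subset[OF holomorphic_riemann_zeta]) auto
  have "defect_sum 1 \<circ> (\<lambda>s. s + 1) holomorphic_on {s. Re s > -1} - {1}"
    by (rule holomorphic_on_compose_gen[OF _ holomorphic_defect_sum]) (auto intro!: holomorphic_intros)
  then have "(\<lambda>s. defect_sum 1 (s + 1)) holomorphic_on {s. Re s > -1} - {1}" by (simp add: o_def)
  moreover have "defect_sum 2 holomorphic_on {s. Re s > -1} - {1}"
    by (rule holomorphic_on_subset[OF holomorphic_defect_sum]) auto
  ultimately show "(\<lambda>s. (1 - s) / 2 * defect_sum 1 (s + 1) - defect_sum 2 s + (1 - s) / 2 - 1) holomorphic_on {s. Re s > -1} - {1}"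
    by (intro holomorphic_intros) auto
next
  fix s :: complex assume "s \<in> {s. Re s > 1}"
  then have s: "Re s > 1" by simp
  have "binomial_defect 1 n (s + 1) = of_nat (Suc (Suc n)) powr (-s) - of_nat (Suc n) powr (-s) + s * of_nat (Suc n) powr (- (s + 1))" for n
  proof -
    have "1 - (s + 1) = - s" by simp
    then show ?thesis unfolding binomial_defect_1 by simp
  qed
  then have 1: "(\<lambda>n. of_nat (Suc (Suc n)) powr (-s) - of_nat (Suc n) powr (-s) + s * of_nat (Suc n) powr (- (s + 1))) sums defect_sum 1 (s + 1)"
    using defect_sum_sums[of 1 "s + 1"] s by simp
  have 2: "(\<lambda>n. of_nat (Suc (Suc n)) powr (-s) - of_nat (Suc n) powr (-s) + s * of_nat (Suc n) powr (- (s + 1))) sums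
         (0 - of_nat (Suc 0) powr (-s) + s * zeta_series (s + 1))"
  proof (intro sums_add sums_mult zeta_series_sums telescope_sums)
    show "(\<lambda>n. of_nat (Suc n) powr (-s) :: complex) \<longlonglongrightarrow> 0"
      using zeta_series_sums[OF s] by (intro summable_LIMSEQ_zero sums_summable)
  qed (use s in auto)
  from 1 2 have d1: "defect_sum 1 (s + 1) = s * zeta_series (s + 1) - 1" by (simp add: sums_unique2)
  have "(\<Sum>j\<le>Suc 0. ((1 - s) gchoose Suc j) * zeta_series (s + of_nat j)) + defect_sum (Suc (Suc 0)) s = -1"
    by (rule zeta_series_defect_identity[OF s])
  then have d2: "defect_sum 2 s = - 1 - (1 - s) * zeta_series s + (1 - s) * s / 2 * zeta_series (s + 1)"
    by (simp add: numeral_2_eq_2 gbinomial_Suc field_simps)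
  show "(1 - s) * riemann_zeta s = (1 - s) / 2 * defect_sum 1 (s + 1) - defect_sum 2 s + (1 - s) / 2 - 1"
    unfolding d1 d2 riemann_zeta_eq_series[OF s] by (simp add: field_simps)
qed (use assms in \<open>auto simp: open_halfspace_Re_gt\<close>)

text \<open>At \<open>s = -\<beta>\<close> the right side of \<open>riemann_zeta_strip\<close> is,
  up to constants, a convergent series of trapezoidal errors, whose partial sums are
  \<open>1 + \<beta>\<close> times the sequence of the statement, up to a constant and an index
  shift.\<close>

lemma riemann_zeta_neg_limit:
  fixes \<beta> :: real
  assumes "0 < \<beta>" and "\<beta> < 1"
  shows "(\<lambda>n. (\<Sum>m\<le>n. real m powr \<beta>) - real n powr (1 + \<beta>) / (1 + \<beta>) - real n powr \<beta> / 2) \<longlonglongrightarrow> Re (riemann_zeta (of_real (-\<beta>)))"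
proof -
  define s where "s = complex_of_real (-\<beta>)"
  define T where "T = (\<lambda>n. (1 + \<beta>) / 2 * (real (Suc n) powr \<beta> + real (Suc (Suc n)) powr \<beta>) - (real (Suc (Suc n)) powr (1 + \<beta>) - real (Suc n) powr (1 + \<beta>)))"
  have pw: "of_nat k powr complex_of_real x = of_real (real k powr x)" for k x
    using powr_of_real[of "real k" x] by simp
  \<comment> \<open>\<open>T\<close> is \<open>1 + \<beta>\<close> times the error of the trapezoidal rule for \<open>x powr \<beta>\<close> on one unit interval.\<close>
  have T: "(1 - s) / 2 * binomial_defect 1 n (s + 1) - binomial_defect 2 n s = of_real (T n)" for n
  proof -
    define N where "N = (of_nat (Suc n) :: complex)"
    define M where "M = (of_nat (Suc (Suc n)) :: complex)"
    have "(1 - s) / 2 * binomial_defect 1 n (s + 1) - binomial_defect 2 n s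
       = (1 - s) / 2 * (M powr (-s) - N powr (-s) + s * N powr (-s - 1))
         - (M powr (1 - s) - N powr (1 - s) - (1 - s) * N powr (-s) + (1 - s) * s / 2 * N powr (- s - 1))"
    proof -
      have "1 - (s + 1) = - s" "- (s + 1) = - s - 1" by simp_all
      then show ?thesis
        unfolding binomial_defect_1 binomial_defect_2 N_def[symmetric] M_def[symmetric] by simp
    qed
    \<comment> \<open>The weight \<open>(1 - s) / 2\<close> makes the \<open>N powr (-s - 1)\<close>
      terms cancel.\<close>
    also have "\<dots> = (1 - s) / 2 * (N powr (-s) + M powr (-s)) - (M powr (1 - s) - N powr (1 - s))"
      by (simp add: field_simps)
    finally have eq: "(1 - s) / 2 * binomial_defect 1 n (s + 1) - binomial_defect 2 n s
       = (1 - s) / 2 * (N powr (-s) + M powr (-s)) - (M powr (1 - s) - N powr (1 - s))" .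
    have e: "- s = of_real \<beta>" "1 - s = of_real (1 + \<beta>)" by (simp_all add: s_def)
    have "(1 - s) / 2 * (N powr (-s) + M powr (-s)) - (M powr (1 - s) - N powr (1 - s)) = of_real (T n)"
      unfolding e N_def M_def pw T_def by simp
    then show ?thesis unfolding eq .
  qed
  have "(\<lambda>n. (1 - s) / 2 * binomial_defect 1 n (s + 1) - binomial_defect 2 n s) sums
      ((1 - s) / 2 * defect_sum 1 (s + 1) - defect_sum 2 s)"
    using assms by (intro sums_diff sums_mult defect_sum_sums) (auto simp: s_def)
  also have "(1 - s) / 2 * defect_sum 1 (s + 1) - defect_sum 2 s = (1 - s) * riemann_zeta s - (1 - s) / 2 + 1"
  proof -
    have "s \<noteq> 1" using assms unfolding s_def by (metis Re_complex_of_real one_complex.sel(1) neg_less_0_iff_less less_trans not_one_less_zero)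
    then show ?thesis using riemann_zeta_strip[of s] assms by (simp add: s_def)
  qed
  finally have "(\<lambda>n. Re (of_real (T n))) sums Re ((1 - s) * riemann_zeta s - (1 - s) / 2 + 1)"
    unfolding T by (rule sums_Re)
  then have "T sums ((1 + \<beta>) * Re (riemann_zeta s) - (1 + \<beta>) / 2 + 1)"
    by (simp add: s_def)
  then have "(\<lambda>n. \<Sum>k<n. T k) \<longlonglongrightarrow> (1 + \<beta>) * Re (riemann_zeta s) - (1 + \<beta>) / 2 + 1"
    by (simp add: sums_def)
  then have "(\<lambda>n. ((\<Sum>k<n. T k) + (1 + \<beta>) / 2 - 1) / (1 + \<beta>)) \<longlonglongrightarrow> ((1 + \<beta>) * Re (riemann_zeta s) - (1 + \<beta>) / 2 + 1 + (1 + \<beta>) / 2 - 1) / (1 + \<beta>)"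
    using assms by (intro tendsto_intros) auto
  also have "((1 + \<beta>) * Re (riemann_zeta s) - (1 + \<beta>) / 2 + 1 + (1 + \<beta>) / 2 - 1) / (1 + \<beta>) = Re (riemann_zeta s)"
    using assms by simp
  also have "(\<lambda>n. ((\<Sum>k<n. T k) + (1 + \<beta>) / 2 - 1) / (1 + \<beta>))
     = (\<lambda>n. (\<Sum>m\<le>Suc n. real m powr \<beta>) - real (Suc n) powr (1 + \<beta>) / (1 + \<beta>) - real (Suc n) powr \<beta> / 2)"
  proof
    fix n
    \<comment> \<open>Each interior node is counted from two intervals and the end nodes from one.
      The constants come from the node 1; the term \<open>m = 0\<close> vanishes since
      \<open>0 powr \<beta> = 0\<close>.\<close>
    have "(\<Sum>k<n. T k) = (1 + \<beta>) * ((\<Sum>m\<le>Suc n. real m powr \<beta>) - real (Suc n) powr \<beta> / 2) - real (Suc n) powr (1 + \<beta>) - (1 + \<beta>) / 2 + 1"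
      by (induction n) (simp_all add: T_def field_simps del: of_nat_Suc, simp_all)
    then show "((\<Sum>k<n. T k) + (1 + \<beta>) / 2 - 1) / (1 + \<beta>) =
      (\<Sum>m\<le>Suc n. real m powr \<beta>) - real (Suc n) powr (1 + \<beta>) / (1 + \<beta>) - real (Suc n) powr \<beta> / 2"
      using assms by (simp add: diff_divide_distrib del: of_nat_Suc sum.atMost_Suc)
  qed
  finally show ?thesis unfolding s_def by (rule LIMSEQ_imp_Suc)
qed

section \<open>Coefficients of powers of 1 - z\<close>

text \<open>The coefficient of \<open>z\<^sup>n\<close> in \<open>(1 - z)\<^sup>-\<^sup>g\<close>.\<close>

definition rising_coeff :: "real \<Rightarrow> nat \<Rightarrow> real" where
  "rising_coeff g n = pochhammer g n / fact n"

section \<open>Asymptotic expansion of the coefficients\<close>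

lemma rising_coeff_Suc: "rising_coeff g (Suc n) = rising_coeff g n * ((g + real n) / real (Suc n))"
  by (simp add: rising_coeff_def pochhammer_Suc)

text \<open>Euler's limit for the reciprocal Gamma function. Its sequence carries one more factor
  \<open>g + n\<close>, which \<open>n / (n + g)\<close> removes. Using \<open>rGamma\<close> admits
  every real \<open>g\<close>, including the poles of Gamma.\<close>

lemma rising_coeff_powr_LIMSEQ:
  "(\<lambda>n. rising_coeff g n * real n powr (1 - g)) \<longlonglongrightarrow> rGamma g"
proof -
  have "(\<lambda>n. rGamma_series g n * (real n / (real n + g))) \<longlonglongrightarrow> rGamma g * 1"
    by (intro tendsto_mult rGamma_series_LIMSEQ) real_asymp
  moreover have "\<forall>\<^sub>F n in sequentially.
      rGamma_series g n * (real n / (real n + g)) = rising_coeff g n * real n powr (1 - g)"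
    using eventually_gt_at_top[of "nat \<lceil>\<bar>g\<bar>\<rceil>"]
  proof eventually_elim
    case (elim n)
    then have n: "real n > 0" "real n + g > 0" by linarith+
    have "rGamma_series g n = rising_coeff g n * (real n + g) / real n powr g"
      using n by (simp add: rGamma_series_def rising_coeff_def pochhammer_Suc powr_def add_ac)
    then show ?case using n by (simp add: powr_diff)
  qed
  ultimately show ?thesis by (auto elim: Lim_transform_eventually)
qed

text \<open>The difference of consecutive values of \<open>1 / n ^ 3\<close> dominates
  \<open>1 / n ^ 4\<close>. Hence, for a suitable \<open>C\<close>, \<open>e n + C / n ^ 3\<close>
  eventually decreases to \<open>L\<close> and \<open>e n - C / n ^ 3\<close> increases to
  it.\<close>

lemma tendsto_remainder_of_difference:
  fixes e :: "nat \<Rightarrow> real"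
  assumes lim: "e \<longlonglongrightarrow> L" and diff: "(\<lambda>n. e (Suc n) - e n) \<in> O(\<lambda>n. 1 / real n ^ 4)"
  shows "(\<lambda>n. e n - L) \<in> O(\<lambda>n. 1 / real n ^ 3)"
proof -
  have "(\<lambda>n. 1 / real n ^ 4) \<in> O(\<lambda>n. 1 / real n ^ 3 - 1 / real (Suc n) ^ 3)"
    by real_asymp
  with diff have "(\<lambda>n. e (Suc n) - e n) \<in> O(\<lambda>n. 1 / real n ^ 3 - 1 / real (Suc n) ^ 3)"
    by (rule landau_o.big_trans)
  then obtain C where C: "C > 0" and
    ev: "\<forall>\<^sub>F n in sequentially. norm (e (Suc n) - e n) \<le> C * norm (1 / real n ^ 3 - 1 / real (Suc n) ^ 3)"
    by (auto elim: landau_o.bigE)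
  then obtain N where N: "N > 0" and
    b: "\<And>n. n \<ge> N \<Longrightarrow> norm (e (Suc n) - e n) \<le> C * norm (1 / real n ^ 3 - 1 / real (Suc n) ^ 3)"
    unfolding eventually_at_top_linorder by (metis le_trans max.cobounded1 max.cobounded2 zero_less_Suc less_le_trans)
  have b': "\<bar>e (Suc n) - e n\<bar> \<le> C * (1 / real n ^ 3 - 1 / real (Suc n) ^ 3)" if "n \<ge> N" for n
  proof -
    have "1 / real (Suc n) ^ 3 \<le> 1 / real n ^ 3"
      using N that by (intro divide_left_mono power_mono) auto
    then show ?thesis using b[OF that] by simp
  qed
  have z: "(\<lambda>n. C / real n ^ 3) \<longlonglongrightarrow> 0" by real_asymp
  have up: "(\<lambda>n. e n + C / real n ^ 3) \<longlonglongrightarrow> L" and lo: "(\<lambda>n. e n - C / real n ^ 3) \<longlonglongrightarrow> L"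
    using tendsto_add[OF lim z] tendsto_diff[OF lim z] by simp_all
  have "\<bar>e n - L\<bar> \<le> C * norm (1 / real n ^ 3)" if n: "n \<ge> N" for n
  proof -
    have "e (m + n) + C / real (m + n) ^ 3 \<le> e n + C / real n ^ 3" for m
    proof (induction m)
      case (Suc m)
      show ?case using b'[of "m + n"] n Suc by (simp add: algebra_simps)
    qed auto
    then have "L \<le> e n + C / real n ^ 3"
      using LIMSEQ_ignore_initial_segment[OF up, of n] by (intro LIMSEQ_le_const2) auto
    moreover have "e (m + n) - C / real (m + n) ^ 3 \<ge> e n - C / real n ^ 3" for m
    proof (induction m)
      case (Suc m)
      show ?case using b'[of "m + n"] n Suc by (simp add: algebra_simps)
    qed auto
    then have "L \<ge> e n - C / real n ^ 3"
      using LIMSEQ_ignore_initial_segment[OF lo, of n] by (intro LIMSEQ_le_const) auto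
    ultimately show ?thesis by (simp add: abs_le_iff)
  qed
  then show ?thesis
    by (intro bigoI[where c = C]) (auto simp: eventually_at_top_linorder)
qed

text \<open>With \<open>y = 1 / n\<close> and denominators cleared, this says that \<open>a\<close>
  and \<open>b\<close> kill all orders below \<open>y^4\<close> in the step of the corrected
  sequence.\<close>

lemma gamma_ratio_polynomial_identity:
  fixes g y :: real
  assumes "a = g*(g-1)/2" "b = a\<^sup>2 - g*(g-1)*(g-2)*(3*g-1)/24"
   "t4 = - g * (g*(g+1)*(g+2)/6)" "t3 = g*(g+1)*(g-1)/3" "t2 = g*(1-g)/2" "d1 = 2 - a" "d2 = 1-a+b"
  shows "(1+g*y) * (1 - g*y + g*(g+1)/2*y^2 - g*(g+1)*(g+2)/6*y^3) * ((1+y)^2 - a*y*(1+y) + b*y^2)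
    - (1 - a*y+b*y^2)*(1+y)^2 = y^4 * ((t4 + t3*d1 + t2*d2 - b) + (t4*d1+t3*d2) * y + t4*d2*y^2)"
  unfolding assms by (simp add: field_simps power2_eq_square power3_eq_cube power4_eq_xxxx)

text \<open>The limit of \<open>v\<close> comes without a rate, but its successive ratio
  \<open>(1 + g / n) * (1 + 1 / n) powr (-g)\<close> is explicit. The corrected sequence
  \<open>e\<close> has steps of order \<open>n^(-4)\<close>, so it is within \<open>n^(-3)\<close>
  of its limit; multiplying by \<open>p\<close> undoes the correction.\<close>

lemma rising_coeff_expansion:
  fixes g q :: real
  defines "q \<equiv> g * (g - 1) * (g - 2) * (3 * g - 1) / 24"
  shows "(\<lambda>n. rising_coeff g n - rGamma g * (real n powr (g - 1)
              * (1 + g * (g - 1) / 2 / real n + q / real n ^ 2))) \<in> O(\<lambda>n. real n powr (g - 4))"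
proof -
  \<comment> \<open>\<open>1 - a y + b y\<^sup>2\<close> is the inverse of \<open>1 + a y + q y\<^sup>2\<close> up to \<open>O(y\<^sup>3)\<close>; multiplying by it makes
    consecutive terms agree up to \<open>O(n\<^sup>-\<^sup>4)\<close>.\<close>
  define a where "a = g * (g - 1) / 2"
  define b where "b = a\<^sup>2 - q"
  define pt where "pt = (\<lambda>y. 1 - a * y + b * y\<^sup>2)"
  define v where "v = (\<lambda>n. rising_coeff g n * real n powr (1 - g))"
  define e where "e = (\<lambda>n. v n * pt (1 / real n))"
  have v: "v \<longlonglongrightarrow> rGamma g" unfolding v_def by (rule rising_coeff_powr_LIMSEQ)
  then have vO: "v \<in> O(\<lambda>_. 1)"
    by (intro bigoI_tendsto[where c = "rGamma g"]) auto
  have "(\<lambda>n. pt (1 / real n)) \<longlonglongrightarrow> 1 - a * 0 + b * 0\<^sup>2"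
    unfolding pt_def by (intro tendsto_intros lim_1_over_n)
  from tendsto_mult[OF v this] have e: "e \<longlonglongrightarrow> rGamma g" by (simp add: e_def)
  \<comment> \<open>The Taylor polynomial of degree 3 of \<open>(1 + y) powr (-g)\<close>. Replacing
    the power by it costs \<open>O(n^(-4))\<close> and leaves a rational function.\<close>
  define T where "T = (\<lambda>y::real. 1 - g*y + g*(g+1)/2*y^2 - g*(g+1)*(g+2)/6*y^3)"
  have T: "(\<lambda>n. (1 + 1 / real n) powr (-g) - T (1 / real n)) \<in> O(\<lambda>n. 1 / real n ^ 4)"
  proof -
    have eq: "(\<Sum>j\<le>3. ((-g) gchoose j) * y ^ j) = T y" for y
      by (simp add: T_def numeral_eq_Suc gbinomial_Suc field_simps)
    from one_plus_inverse_powr_expansion[of "-g" 3, unfolded eq] show ?thesis by simp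
  qed
  have 1: "(\<lambda>n. (1 + g / real n) * pt (1 / (real n + 1)) * ((1 + 1 / real n) powr (-g) - T (1 / real n)))
           \<in> O(\<lambda>n. 1 * (1 / real n ^ 4))"
    by (intro landau_o.big.mult T, unfold pt_def) real_asymp
  have 2: "(\<lambda>n. (1 + g / real n) * pt (1 / (real n + 1)) * T (1 / real n) - pt (1 / real n))
            \<in> O(\<lambda>n. 1 / real n ^ 4)"
  proof -
    \<comment> \<open>\<open>t2\<close>, \<open>t3\<close>, \<open>t4\<close> are the coefficients
      of \<open>(1 + g * y) * T y\<close>, whose linear term vanishes; \<open>d1\<close> and
      \<open>d2\<close> are those of \<open>(1 + y)^2 * pt (y / (1 + y))\<close>.\<close>
    define t4 t3 t2 d1 d2 where
     t: "t4 = - g * (g*(g+1)*(g+2)/6)" "t3 = g*(g+1)*(g-1)/3" "t2 = g*(1-g)/2" "d1 = 2 - a" "d2 = 1-a+b"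
    define c4 c5 c6 where c: "c4 = t4 + t3*d1 + t2*d2 - b" "c5 = t4*d1+t3*d2" "c6 = t4*d2"
    have "(\<lambda>n. (1/real n)^4 * (c4 + c5 * (1/real n) + c6 * (1/real n)^2)/(1+1/real n)^2)
            \<in> O(\<lambda>n. 1/real n^4)"
      by real_asymp
    moreover have "\<forall>\<^sub>F n in sequentially.
       (1 + g / real n) * pt (1 / (real n + 1)) * T (1 / real n) - pt (1 / real n)
         = (1/real n)^4 * (c4 + c5 * (1/real n) + c6 * (1/real n)^2)/(1+1/real n)^2"
      using eventually_gt_at_top[of 0]
    proof eventually_elim
      case (elim n)
      define y where "y = 1 / real n"
      have y: "y > 0" using elim by (simp add: y_def)
      have y1: "1 / (real n + 1) = y / (1 + y)" using elim by (simp add: y_def field_simps)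
      have "pt (y / (1 + y)) = ((1+y)^2 - a*y*(1+y) + b*y^2) / (1 + y)^2"
      proof -
        have "1 - a * (y / z) + b * (y / z)\<^sup>2 = (z\<^sup>2 - a * y * z + b * y\<^sup>2) / z\<^sup>2" if "z > 0" for z
          using that by (simp add: field_simps power2_eq_square)
        from this[of "1 + y"] y show ?thesis by (simp add: pt_def)
      qed
      then have "(1 + g * y) * pt (y / (1 + y)) * T y - pt y
         = ((1+g*y) * T y * ((1+y)^2 - a*y*(1+y) + b*y^2) - pt y *(1+y)^2) / (1+y)^2"
        using y by (simp add: diff_divide_distrib mult_ac)
      also have "(1+g*y) * T y * ((1+y)^2 - a*y*(1+y) + b*y^2) - pt y *(1+y)^2
           = y^4 * (c4 + c5 * y + c6 * y^2)"
        unfolding T_def pt_def c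
        by (rule gamma_ratio_polynomial_identity) (simp_all add: t a_def b_def q_def)
      finally show ?case by (simp add: y1 flip: y_def) (simp add: y_def)
    qed
    ultimately show ?thesis by (simp add: landau_o.big.in_cong)
  qed
  have "(\<lambda>n. (1 + g / real n) * pt (1 / (real n + 1)) * ((1 + 1 / real n) powr (-g) - T (1 / real n))
          + ((1 + g / real n) * pt (1 / (real n + 1)) * T (1 / real n) - pt (1 / real n)))
           \<in> O(\<lambda>n. 1 / real n ^ 4)"
    by (intro sum_in_bigo 2) (use 1 in simp)
  then have "(\<lambda>n. v n * ((1 + g / real n) * (1 + 1 / real n) powr (-g) * pt (1 / (real n + 1)) - pt (1 / real n)))
           \<in> O(\<lambda>n. 1 * (1 / real n ^ 4))"
    by (intro landau_o.big.mult vO) (simp add: algebra_simps)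
  also have "?this \<longleftrightarrow> (\<lambda>n. e (Suc n) - e n) \<in> O(\<lambda>n. 1 / real n ^ 4)"
  proof (rule landau_o.big.cong_ex, goal_cases)
    case 1
    show ?case
      using eventually_gt_at_top[of 0]
    proof eventually_elim
      case (elim n)
      have "v (Suc n) = v n * ((1 + g / real n) * (1 + 1 / real n) powr (-g))"
      proof -
        have "1 + 1 / real n = real (Suc n) / real n" using elim by (simp add: field_simps)
        then have "(1 + 1 / real n) powr (-g) = real (Suc n) powr (-g) / real n powr (-g)"
          by (simp add: powr_divide)
        moreover have "real (Suc n) powr (1 - g) = real (Suc n) * real (Suc n) powr (-g)"
          "real n powr (1 - g) = real n * real n powr (-g)"
          using elim powr_add[of _ 1 "-g"] by simp_all
        moreover have "real n powr (-g) > 0" using elim by simp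
        ultimately show ?thesis
          using elim by (simp add: v_def rising_coeff_Suc field_simps)
      qed
      then show ?case by (simp add: e_def algebra_simps)
    qed
  qed simp
  finally have E: "(\<lambda>n. e n - rGamma g) \<in> O(\<lambda>n. 1 / real n ^ 3)"
    by (intro tendsto_remainder_of_difference e)
  define p where "p = (\<lambda>n. 1 + a / real n + q / real n ^ 2)"
  have p: "p \<in> O(\<lambda>_. 1)" unfolding p_def by real_asymp
  have 3: "(\<lambda>n. p n * (e n - rGamma g)) \<in> O(\<lambda>n. 1 * (1 / real n ^ 3))"
    by (intro landau_o.big.mult p E)
  \<comment> \<open>The factor of \<open>v n\<close> is \<open>1 - p n * pt (1 / n)\<close>, the
    failure of \<open>p\<close> to be the exact inverse of the correction.\<close>
  have 4: "(\<lambda>n. v n * ((a ^ 3 - 2 * a * b) / real n ^ 3 - b * q / real n ^ 4)) \<in> O(\<lambda>n. 1 * (1 / real n ^ 3))"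
    by (intro landau_o.big.mult vO) real_asymp
  have "(\<lambda>n. p n * (e n - rGamma g) + v n * ((a ^ 3 - 2 * a * b) / real n ^ 3 - b * q / real n ^ 4))
          \<in> O(\<lambda>n. 1 / real n ^ 3)"
    using 3 4 by (intro sum_in_bigo) auto
  then have "(\<lambda>n. real n powr (g - 1) * (p n * (e n - rGamma g) + v n * ((a ^ 3 - 2 * a * b) / real n ^ 3 - b * q / real n ^ 4)))
     \<in> O(\<lambda>n. real n powr (g - 1) * (1 / real n ^ 3))"
    by (intro landau_o.big.mult) auto
  also have "?this \<longleftrightarrow> (\<lambda>n. rising_coeff g n - rGamma g * (real n powr (g - 1) * p n)) \<in> O(\<lambda>n. real n powr (g - 4))"
  proof (rule landau_o.big.cong_ex, goal_cases)
    case 1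
    show ?case
      using eventually_gt_at_top[of 0]
    proof eventually_elim
      case (elim n)
      have "real n powr (g - 1) * real n powr (1 - g) = 1"
        using elim by (simp flip: powr_add)
      then have rc: "rising_coeff g n = real n powr (g - 1) * v n" by (simp add: v_def mult_ac)
      have "p n * pt (1 / real n) + ((a ^ 3 - 2 * a * b) / real n ^ 3 - b * q / real n ^ 4) = 1"
        using elim unfolding p_def pt_def b_def
        by (simp add: field_simps power2_eq_square power3_eq_cube power4_eq_xxxx)
      then have "v n * (p n * pt (1 / real n) + ((a ^ 3 - 2 * a * b) / real n ^ 3 - b * q / real n ^ 4)) = v n"
        by simp
      then have "p n * (e n - rGamma g) + v n * ((a ^ 3 - 2 * a * b) / real n ^ 3 - b * q / real n ^ 4) = v n - rGamma g * p n"
        by (simp add: e_def algebra_simps)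
      then show ?case by (simp add: rc algebra_simps)
    qed
  next
    case 2
    show ?case
      using eventually_gt_at_top[of 0]
    proof eventually_elim
      case (elim n)
      then show ?case by (simp add: powr_diff powr_numeral power3_eq_cube power4_eq_xxxx)
    qed
  qed
  finally show ?thesis by (simp add: p_def a_def)
qed

section \<open>Truncated expansions and convolution identities\<close>

lemma powr_bigo_mono:
  fixes a b :: real
  assumes "a \<le> b"
  shows "(\<lambda>n. real n powr a) \<in> O(\<lambda>n. real n powr b)"
proof (rule bigoI[where c = 1])
  show "\<forall>\<^sub>F n in sequentially. norm (real n powr a) \<le> 1 * norm (real n powr b)"
    using eventually_gt_at_top[of 0]
    by eventually_elim (use assms in \<open>auto intro!: powr_mono\<close>)
qed

lemma rising_coeff_expansion_1:
  "(\<lambda>n. rising_coeff g n - rGamma g * (real n powr (g - 1) * (1 + g * (g - 1) / 2 / real n)))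
     \<in> O(\<lambda>n. real n powr (g - 3))"
proof -
  define q where "q = g * (g - 1) * (g - 2) * (3 * g - 1) / 24"
  have "(\<lambda>n. rising_coeff g n - rGamma g * (real n powr (g - 1)
              * (1 + g * (g - 1) / 2 / real n + q / real n ^ 2))) \<in> O(\<lambda>n. real n powr (g - 3))"
    unfolding q_def by (rule landau_o.big_trans[OF rising_coeff_expansion powr_bigo_mono]) simp
  moreover have "(\<lambda>n. rGamma g * (real n powr (g - 1) * (q / real n ^ 2))) \<in> O(\<lambda>n. real n powr (g - 3))"
    by real_asymp
  ultimately show ?thesis
    by (rule sum_in_bigo(1)[THEN landau_o.big.in_cong[THEN iffD1, rotated]]) (auto simp: algebra_simps)
qed

lemma rising_coeff_expansion_0:
  "(\<lambda>n. rising_coeff g n - rGamma g * real n powr (g - 1)) \<in> O(\<lambda>n. real n powr (g - 2))"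
proof -
  define q where "q = g * (g - 1) / 2"
  have "(\<lambda>n. rising_coeff g n - rGamma g * (real n powr (g - 1) * (1 + q / real n)))
           \<in> O(\<lambda>n. real n powr (g - 2))"
    unfolding q_def by (rule landau_o.big_trans[OF rising_coeff_expansion_1 powr_bigo_mono]) simp
  moreover have "(\<lambda>n. rGamma g * (real n powr (g - 1) * (q / real n))) \<in> O(\<lambda>n. real n powr (g - 2))"
    by real_asymp
  ultimately show ?thesis
    by (rule sum_in_bigo(1)[THEN landau_o.big.in_cong[THEN iffD1, rotated]]) (auto simp: algebra_simps)
qed

lemma rising_coeff_bigo: "rising_coeff g \<in> O(\<lambda>n. real n powr (g - 1))"
proof -
  have "(\<lambda>n. rising_coeff g n - rGamma g * real n powr (g - 1)) \<in> O(\<lambda>n. real n powr (g - 1))"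
    by (rule landau_o.big_trans[OF rising_coeff_expansion_0 powr_bigo_mono]) simp
  moreover have "(\<lambda>n. rGamma g * real n powr (g - 1)) \<in> O(\<lambda>n. real n powr (g - 1))"
    by simp
  ultimately show ?thesis
    by (rule sum_in_bigo(1)[THEN landau_o.big.in_cong[THEN iffD1, rotated]]) auto
qed

text \<open>The Vandermonde identity, that is, the product rule for powers of \<open>1 - z\<close>.
  With \<open>y = 1\<close> all second factors are 1 and it becomes partial summation.\<close>

lemma rising_coeff_convolution:
  "(\<Sum>k\<le>n. rising_coeff x k * rising_coeff y (n - k)) = rising_coeff (x + y) n"
proof -
  have "rising_coeff x k * rising_coeff y (n - k)
      = of_nat (n choose k) * pochhammer x k * pochhammer y (n - k) / fact n" if "k \<le> n" for k
    using that by (simp add: rising_coeff_def binomial_fact)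
  then show ?thesis
    by (simp add: rising_coeff_def pochhammer_binomial_sum sum_divide_distrib)
qed

lemma rising_coeff_1 [simp]: "rising_coeff 1 n = 1"
  by (simp add: rising_coeff_def flip: pochhammer_fact)

lemma sum_rising_coeff: "(\<Sum>k\<le>n. rising_coeff g k) = rising_coeff (g + 1) n"
  using rising_coeff_convolution[of g 1 n] by simp

lemma rising_coeff_diff: "rising_coeff g (Suc n) - rising_coeff g n = rising_coeff (g - 1) (Suc n)"
  using sum_rising_coeff[of "g - 1" n] sum_rising_coeff[of "g - 1" "Suc n"] by simp

lemma rising_coeff_diff_bigo:
  "(\<lambda>n. rising_coeff g (Suc n) - rising_coeff g n) \<in> O(\<lambda>n. real n powr (g - 2))"
proof -
  have "(\<lambda>n. rising_coeff (g - 1) (Suc n)) \<in> O(\<lambda>n. real (Suc n) powr (g - 1 - 1))"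
    using rising_coeff_bigo[of "g - 1"] filterlim_Suc by (rule landau_o.big.compose)
  also have "(\<lambda>n. real (Suc n) powr (g - 1 - 1)) \<in> O(\<lambda>n. real n powr (g - 2))"
    by real_asymp
  finally show ?thesis by (simp add: rising_coeff_diff)
qed

text \<open>The mass of \<open>r\<close> sits at small indices, where \<open>w (n - m)\<close> is
  close to \<open>w n\<close>; for \<open>m > n / 2\<close> the value \<open>r m\<close> itself is
  small. Telescoping \<open>w\<close> over \<open>m\<close> steps costs a factor \<open>m\<close>,
  so \<open>r\<close> needs a finite first moment, which \<open>p > 2\<close> ensures.\<close>

lemma convolution_expansion:
  fixes w r :: "nat \<Rightarrow> real"
  assumes a: "a > 0" and p: "p > 2"
    and w: "w \<in> O(\<lambda>n. real n powr (-a-1))"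
    and dw: "(\<lambda>n. w (Suc n) - w n) \<in> O(\<lambda>n. real n powr (-a-2))"
    and r: "r \<in> O(\<lambda>n. real n powr (-p))"
  shows "(\<lambda>n. (\<Sum>k\<le>n. w k * r (n - k)) - w n * suminf r)
            \<in> O(\<lambda>n. real n powr (-a-2) + real n powr (-p))"
proof -
  have sw: "summable (\<lambda>n. \<bar>w n\<bar>)"
    by (rule summable_comparison_test_bigo[where g = "\<lambda>n. real n powr (-a-1)"])
       (use w a in \<open>auto simp: summable_real_powr_iff\<close>)
  have sr: "summable r"
    by (rule summable_comparison_test_bigo[where g = "\<lambda>n. real n powr (-p)"])
       (use r p in \<open>auto simp: summable_real_powr_iff\<close>)
  have "(\<lambda>n. real n * \<bar>r n\<bar>) \<in> O(\<lambda>n. real n * real n powr (-p))"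
    by (intro landau_o.big.mult) (use r in auto)
  also have "(\<lambda>n. real n * real n powr (-p)) \<in> O(\<lambda>n. real n powr (1 - p))"
    by real_asymp
  finally have smr: "summable (\<lambda>n. real n * \<bar>r n\<bar>)"
    by (rule summable_comparison_test_bigo[rotated, where g = "\<lambda>n. real n powr (1-p)"])
       (use p in \<open>auto simp: summable_real_powr_iff\<close>)
  define W where "W = (\<Sum>n. \<bar>w n\<bar>)"
  define M where "M = (\<Sum>n. real n * \<bar>r n\<bar>)"
  have M0: "M \<ge> 0" unfolding M_def by (intro suminf_nonneg smr) auto
  obtain C D E N where N: "C > 0" "D > 0" "E > 0" "N > 0"
    and C: "\<And>n. n \<ge> N \<Longrightarrow> \<bar>w n\<bar> \<le> C * real n powr (-a-1)"
    and D: "\<And>n. n \<ge> N \<Longrightarrow> \<bar>w (Suc n) - w n\<bar> \<le> D * real n powr (-a-2)"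
    and E: "\<And>n. n \<ge> N \<Longrightarrow> \<bar>r n\<bar> \<le> E * real n powr (-p)"
  proof -
    obtain C where C: "C > 0" "\<forall>\<^sub>F n in sequentially. norm (w n) \<le> C * norm (real n powr (-a-1))"
      using w by (auto elim: landau_o.bigE)
    obtain D where D: "D > 0" "\<forall>\<^sub>F n in sequentially. norm (w (Suc n) - w n) \<le> D * norm (real n powr (-a-2))"
      using dw by (auto elim: landau_o.bigE)
    obtain E where E: "E > 0" "\<forall>\<^sub>F n in sequentially. norm (r n) \<le> E * norm (real n powr (-p))"
      using r by (auto elim: landau_o.bigE)
    have "\<forall>\<^sub>F n in sequentially. norm (w n) \<le> C * norm (real n powr (-a-1)) \<and>
       norm (w (Suc n) - w n) \<le> D * norm (real n powr (-a-2)) \<and> norm (r n) \<le> E * norm (real n powr (-p)) \<and> n > 0"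
      using C(2) D(2) E(2) eventually_gt_at_top[of 0] by eventually_elim auto
    then obtain N where "\<forall>n\<ge>N. norm (w n) \<le> C * norm (real n powr (-a-1)) \<and>
       norm (w (Suc n) - w n) \<le> D * norm (real n powr (-a-2)) \<and> norm (r n) \<le> E * norm (real n powr (-p)) \<and> n > 0"
      unfolding eventually_at_top_linorder by blast
    then show ?thesis using C(1) D(1) E(1) by (intro that[of C D E N]) auto
  qed
  \<comment> \<open>The powers of 2 come from evaluating at \<open>n / 2\<close>. In
    \<open>3 * C * M\<close>, two parts stem from the indices above \<open>n / 2\<close> and one
    from the tail beyond \<open>n\<close>.\<close>
  define K where "K = D * 2 powr (a+2) * M + E * 2 powr p * W + 3 * C * M"
  have "\<bar>(\<Sum>k\<le>n. w k * r (n - k)) - w n * suminf r\<bar> \<le> K * (real n powr (-a-2) + real n powr (-p))"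
    if n: "n \<ge> 2 * N" for n
  proof -
    have n0: "n > 0" using n N by simp
    define x where "x = real n / 2"
    have x: "x > 0" using n0 by (simp add: x_def)
    \<comment> \<open>One bound covers both halves. For \<open>m\<close> up to \<open>n / 2\<close>
      the \<open>D\<close> term suffices; beyond, the \<open>E\<close> term bounds
      \<open>w (n - m) * r m\<close>, and \<open>w n * r m\<close> is weighted by
      \<open>2 * m / n\<close>, which exceeds 1.\<close>
    have main: "\<bar>(w (n - m) - w n) * r m\<bar> \<le> (D * x powr (-a-2) + \<bar>w n\<bar> * (2 / real n)) * (real m * \<bar>r m\<bar>)
        + E * x powr (-p) * \<bar>w (n - m)\<bar>" if m: "m \<le> n" for m
    proof (cases "2 * m \<le> n")
      case True
      have "\<bar>w (n - j) - w n\<bar> \<le> D * x powr (-a-2) * real j" if "j \<le> m" for j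
        using that
      proof (induction j)
        case (Suc j)
        define k where "k = n - Suc j"
        have k: "n - j = Suc k" "k \<ge> N" "real k \<ge> x"
          using Suc.prems True n n0 by (auto simp: k_def x_def)
        have "\<bar>w (Suc k) - w k\<bar> \<le> D * real k powr (-a-2)" by (intro D k)
        also have "real k powr (-a-2) \<le> x powr (-a-2)"
          using a k x by (intro powr_mono2') auto
        finally have "\<bar>w (Suc k) - w k\<bar> \<le> D * x powr (-a-2)" using N by simp
        moreover have "\<bar>w (Suc k) - w n\<bar> \<le> D * x powr (-a-2) * real j"
          using Suc k by simp
        ultimately show ?case by (simp add: k_def[symmetric] algebra_simps)
      qed simp
      then have "\<bar>w (n - m) - w n\<bar> * \<bar>r m\<bar> \<le> D * x powr (-a-2) * real m * \<bar>r m\<bar>"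
        by (intro mult_right_mono) auto
      moreover have "0 \<le> \<bar>w n\<bar> * (2 / real n) * (real m * \<bar>r m\<bar>) + E * x powr (-p) * \<bar>w (n - m)\<bar>"
        using N by (intro add_nonneg_nonneg mult_nonneg_nonneg) auto
      ultimately have "\<bar>w (n - m) - w n\<bar> * \<bar>r m\<bar> \<le> (D * x powr (-a-2) + \<bar>w n\<bar> * (2 / real n)) * (real m * \<bar>r m\<bar>)
        + E * x powr (-p) * \<bar>w (n - m)\<bar>" by (simp add: algebra_simps)
      then show ?thesis by (simp only: abs_mult)
    next
      case False
      have "m \<ge> N" "real m \<ge> x" using False n by (auto simp: x_def)
      then have "\<bar>r m\<bar> \<le> E * real m powr (-p)" by (intro E)
      also have "real m powr (-p) \<le> x powr (-p)" using p x \<open>real m \<ge> x\<close> by (intro powr_mono2') auto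
      finally have "\<bar>r m\<bar> \<le> E * x powr (-p)" using N by simp
      then have "\<bar>w (n - m)\<bar> * \<bar>r m\<bar> \<le> E * x powr (-p) * \<bar>w (n - m)\<bar>"
        by (metis abs_ge_zero mult.commute mult_left_mono)
      moreover have "\<bar>w n\<bar> * \<bar>r m\<bar> \<le> \<bar>w n\<bar> * (2 / real n) * (real m * \<bar>r m\<bar>)"
      proof -
        have "1 \<le> 2 / real n * real m" using False n0 by (simp add: field_simps)
        then have "\<bar>r m\<bar> \<le> (2 / real n * real m) * \<bar>r m\<bar>"
          using mult_right_mono[of 1 "2 / real n * real m" "\<bar>r m\<bar>"] by simp
        then have "\<bar>w n\<bar> * \<bar>r m\<bar> \<le> \<bar>w n\<bar> * ((2 / real n * real m) * \<bar>r m\<bar>)"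
          by (intro mult_left_mono) auto
        then show ?thesis by (simp only: mult_ac)
      qed
      moreover have "0 \<le> D * x powr (-a-2) * (real m * \<bar>r m\<bar>)"
        using N by (intro mult_nonneg_nonneg) auto
      moreover have "\<bar>(w (n - m) - w n) * r m\<bar> \<le> \<bar>w (n - m)\<bar> * \<bar>r m\<bar> + \<bar>w n\<bar> * \<bar>r m\<bar>"
        unfolding abs_mult by (metis abs_ge_zero abs_triangle_ineq4 distrib_right mult_right_mono)
      ultimately show ?thesis by (simp add: distrib_right)
    qed
    have sM: "(\<Sum>m\<le>n. real m * \<bar>r m\<bar>) \<le> M"
      unfolding M_def by (intro sum_le_suminf smr) auto
    have sW: "(\<Sum>m\<le>n. \<bar>w (n - m)\<bar>) \<le> W"
    proof -
      have "(\<Sum>m\<le>n. \<bar>w (n - m)\<bar>) = (\<Sum>m\<le>n. \<bar>w m\<bar>)"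
        by (rule sum.reindex_bij_witness[of _ "\<lambda>m. n - m" "\<lambda>m. n - m"]) auto
      also have "\<dots> \<le> W" unfolding W_def by (intro sum_le_suminf sw) auto
      finally show ?thesis .
    qed
    have "\<bar>\<Sum>m\<le>n. (w (n - m) - w n) * r m\<bar> \<le> (\<Sum>m\<le>n. \<bar>(w (n - m) - w n) * r m\<bar>)"
      by (rule sum_abs)
    also have "\<dots> \<le> (\<Sum>m\<le>n. (D * x powr (-a-2) + \<bar>w n\<bar> * (2 / real n)) * (real m * \<bar>r m\<bar>)
        + E * x powr (-p) * \<bar>w (n - m)\<bar>)"
      by (intro sum_mono main) auto
    also have "\<dots> = (D * x powr (-a-2) + \<bar>w n\<bar> * (2 / real n)) * (\<Sum>m\<le>n. real m * \<bar>r m\<bar>)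
        + E * x powr (-p) * (\<Sum>m\<le>n. \<bar>w (n - m)\<bar>)"
      by (simp add: sum.distrib sum_distrib_left)
    also have "\<dots> \<le> (D * x powr (-a-2) + \<bar>w n\<bar> * (2 / real n)) * M + E * x powr (-p) * W"
      using N by (intro add_mono mult_left_mono sM sW) auto
    finally have 1: "\<bar>\<Sum>m\<le>n. (w (n - m) - w n) * r m\<bar> \<le>
       (D * x powr (-a-2) + \<bar>w n\<bar> * (2 / real n)) * M + E * x powr (-p) * W" .
    \<comment> \<open>Indices beyond \<open>n\<close> have weight \<open>m / n\<close> at least 1,
      so the first moment also bounds the tail.\<close>
    have 2: "\<bar>w n * (\<Sum>m. r (m + Suc n))\<bar> \<le> \<bar>w n\<bar> * (1 / real n) * M"
    proof -
      have s1: "summable (\<lambda>m. real (m + Suc n) * \<bar>r (m + Suc n)\<bar>)"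
        using smr summable_iff_shift[of "\<lambda>n. real n * \<bar>r n\<bar>" "Suc n"] by blast
      have le: "\<bar>r (m + Suc n)\<bar> \<le> 1 / real n * (real (m + Suc n) * \<bar>r (m + Suc n)\<bar>)" for m
      proof -
        have "1 \<le> 1 / real n * real (m + Suc n)" using n0 by (simp add: field_simps)
        from mult_right_mono[OF this abs_ge_zero[of "r (m + Suc n)"]] show ?thesis by simp
      qed
      have s2: "summable (\<lambda>m. \<bar>r (m + Suc n)\<bar>)"
        by (rule summable_comparison_test'[OF summable_mult[OF s1, of "1 / real n"]]) (use le in auto)
      have "\<bar>\<Sum>m. r (m + Suc n)\<bar> \<le> (\<Sum>m. \<bar>r (m + Suc n)\<bar>)"
        by (rule summable_rabs[OF s2])
      also have "\<dots> \<le> (\<Sum>m. 1 / real n * (real (m + Suc n) * \<bar>r (m + Suc n)\<bar>))"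
        by (intro suminf_le le s2 summable_mult s1)
      also have "\<dots> = 1 / real n * (\<Sum>m. real (m + Suc n) * \<bar>r (m + Suc n)\<bar>)"
        by (rule suminf_mult[OF s1])
      also have "(\<Sum>m. real (m + Suc n) * \<bar>r (m + Suc n)\<bar>) \<le> M"
        unfolding M_def suminf_split_initial_segment[OF smr, of "Suc n"] by (simp add: sum_nonneg)
      finally have "\<bar>\<Sum>m. r (m + Suc n)\<bar> \<le> 1 / real n * M" by (simp add: divide_right_mono)
      from mult_left_mono[OF this abs_ge_zero[of "w n"]] show ?thesis by (simp add: abs_mult mult_ac)
    qed
    have "(\<Sum>k\<le>n. w k * r (n - k)) = (\<Sum>m\<le>n. w (n - m) * r m)"
      by (rule sum.reindex_bij_witness[of _ "\<lambda>m. n - m" "\<lambda>m. n - m"]) auto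
    moreover have "suminf r = (\<Sum>m. r (m + Suc n)) + (\<Sum>m\<le>n. r m)"
      using suminf_split_initial_segment[OF sr, of "Suc n"] by (simp add: lessThan_Suc_atMost)
    ultimately have "(\<Sum>k\<le>n. w k * r (n - k)) - w n * suminf r
        = (\<Sum>m\<le>n. (w (n - m) - w n) * r m) - w n * (\<Sum>m. r (m + Suc n))"
      by (simp add: algebra_simps sum_subtractf sum_distrib_left)
    then have "\<bar>(\<Sum>k\<le>n. w k * r (n - k)) - w n * suminf r\<bar> \<le>
       (D * x powr (-a-2) + \<bar>w n\<bar> * (2 / real n)) * M + E * x powr (-p) * W + \<bar>w n\<bar> * (1 / real n) * M"
      using 1 2 by linarith
    also have "\<dots> = D * x powr (-a-2) * M + E * x powr (-p) * W + \<bar>w n\<bar> / real n * (3 * M)"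
      by (simp add: algebra_simps add_divide_distrib)
    also have "\<dots> \<le> D * x powr (-a-2) * M + E * x powr (-p) * W + C * real n powr (-a-2) * (3 * M)"
    proof -
      have "\<bar>w n\<bar> / real n \<le> C * real n powr (-a-1) / real n"
        using C[of n] n by (intro divide_right_mono) auto
      also have "\<dots> = C * real n powr (-a-2)"
      proof -
        have "real n powr (-a-2) = real n powr ((-a-1) - 1)" by (simp add: algebra_simps)
        also have "\<dots> = real n powr (-a-1) / real n" using n0 by (subst powr_diff) simp
        finally show ?thesis by simp
      qed
      finally show ?thesis using M0 by (intro add_left_mono mult_right_mono) auto
    qed
    also have "x powr (-a-2) = 2 powr (a+2) * real n powr (-a-2)"
      using n0 powr_minus_divide[of 2 "a+2"] by (simp add: x_def powr_divide field_simps)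
    also have "x powr (-p) = 2 powr p * real n powr (-p)"
      using n0 powr_minus_divide[of 2 p] by (simp add: x_def powr_divide field_simps)
    also have "D * (2 powr (a+2) * real n powr (-a-2)) * M + E * (2 powr p * real n powr (-p)) * W
          + C * real n powr (-a-2) * (3 * M) \<le> K * (real n powr (-a-2) + real n powr (-p))"
    proof -
      have "W \<ge> 0" unfolding W_def by (intro suminf_nonneg sw) auto
      then have "0 \<le> (D * 2 powr (a+2) * M + 3 * C * M) * real n powr (-p) + E * 2 powr p * W * real n powr (-a-2)"
        using N M0 by (intro add_nonneg_nonneg mult_nonneg_nonneg) auto
      then show ?thesis by (simp add: K_def algebra_simps)
    qed
    finally show ?thesis .
  qed
  then show ?thesis
    by (intro bigoI[where c = K]) (auto simp: eventually_at_top_linorder)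
qed

section \<open>Expansion of the fractional difference\<close>

text \<open>The three coefficients match the orders \<beta>, \<open>\<beta> - 1\<close> and
  \<open>\<beta> - 2\<close>. The value of \<open>c\<close> stays hidden, as the later estimates
  hold for every \<open>c\<close>.\<close>

lemma powr_rising_coeff_expansion:
  fixes \<beta> :: real
  assumes "0 < \<beta>" and "\<beta> < 1"
  obtains c where "(\<lambda>n. real n powr \<beta> - Gamma (1 + \<beta>) * (rising_coeff (1 + \<beta>) n
      - (1 + \<beta>) / 2 * rising_coeff \<beta> n + c * rising_coeff (\<beta> - 1) n)) \<in> O(\<lambda>n. real n powr (\<beta> - 3))"
proof -
  define G where "G = Gamma (1 + \<beta>)"
  have "1 + \<beta> \<notin> \<int>\<^sub>\<le>\<^sub>0" using assms by (auto elim!: nonpos_Ints_cases)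
  then have G1: "G * rGamma (1 + \<beta>) = 1" by (simp add: G_def Gamma_def rGamma_eq_zero_iff)
  have "G * rGamma \<beta> = \<beta> * (G * rGamma (1 + \<beta>))"
    by (simp add: rGamma_plus1[of \<beta>, symmetric] add.commute)
  with G1 have G2: "G * rGamma \<beta> = \<beta>" by simp
  have "G * rGamma (\<beta> - 1) = (\<beta> - 1) * (G * rGamma \<beta>)"
    by (simp add: rGamma_plus1[of "\<beta> - 1", symmetric])
  with G2 have G3: "G * rGamma (\<beta> - 1) = \<beta> * (\<beta> - 1)" by simp
  define q where "q = (\<lambda>g::real. g * (g - 1) * (g - 2) * (3 * g - 1) / 24)"
  define P where "P = (\<lambda>g n. real n powr (g - 1) * (1 + g * (g - 1) / 2 / real n + q g / real n ^ 2))"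
  define err where "err = (\<lambda>g n. rising_coeff g n - rGamma g * P g n)"
  have err: "err g \<in> O(\<lambda>n. real n powr (\<beta> - 3))" if "g \<le> 1 + \<beta>" for g
    unfolding err_def P_def q_def
    by (rule landau_o.big_trans[OF rising_coeff_expansion powr_bigo_mono]) (use that in simp)
  \<comment> \<open>This value of \<open>c\<close> cancels the term of order \<open>\<beta> - 2\<close>.\<close>
  define c where "c = ((1 + \<beta>) / 2 * \<beta>\<^sup>2 * (\<beta> - 1) / 2 - q (1 + \<beta>)) / (\<beta> * (\<beta> - 1))"
  \<comment> \<open>\<open>k3\<close> and \<open>k4\<close> collect what is left at the orders
    \<open>\<beta> - 3\<close> and \<open>\<beta> - 4\<close>.\<close>
  define k3 where "k3 = (1 + \<beta>) / 2 * \<beta> * q \<beta> - c * \<beta> * (\<beta> - 1) * (\<beta> - 1) * (\<beta> - 2) / 2"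
  define k4 where "k4 = - c * \<beta> * (\<beta> - 1) * q (\<beta> - 1)"
  have "(\<lambda>n. - G * err (1 + \<beta>) n + G * (1 + \<beta>) / 2 * err \<beta> n - G * c * err (\<beta> - 1) n
           + (k3 * real n powr (\<beta> - 3) + k4 * real n powr (\<beta> - 4))) \<in> O(\<lambda>n. real n powr (\<beta> - 3))"
  proof -
    have 1: "(\<lambda>n. k * err g n) \<in> O(\<lambda>n. real n powr (\<beta> - 3))" if "g \<le> 1 + \<beta>" for g k
      using err[OF that] by simp
    have 2: "(\<lambda>n. k * real n powr g) \<in> O(\<lambda>n. real n powr (\<beta> - 3))" if "g \<le> \<beta> - 3" for g k
      using powr_bigo_mono[OF that] by simp
    show ?thesis by (rule sum_in_bigo 1 2 | simp)+
  qed
  also have "?this \<longleftrightarrow> (\<lambda>n. real n powr \<beta> - G * (rising_coeff (1 + \<beta>) n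
      - (1 + \<beta>) / 2 * rising_coeff \<beta> n + c * rising_coeff (\<beta> - 1) n)) \<in> O(\<lambda>n. real n powr (\<beta> - 3))"
  proof (rule landau_o.big.cong_ex, goal_cases)
    case 1
    show ?case using eventually_gt_at_top[of 0]
    proof eventually_elim
      case (elim n)
      define x where "x = real n"
      have x: "x > 0" using elim by (simp add: x_def)
      \<comment> \<open>With the smallest power split off, the comparison becomes a polynomial
        identity in \<open>x\<close>.\<close>
      define X where "X = x powr (\<beta> - 4)"
      have powrs: "x powr \<beta> = X * x ^ 4" "x powr (\<beta> - 1) = X * x ^ 3" "x powr (\<beta> - 2) = X * x\<^sup>2" "x powr (\<beta> - 3) = X * x"
        using x powr_add[of x "\<beta> - 4" 4] powr_add[of x "\<beta> - 4" 3] powr_add[of x "\<beta> - 4" 2] powr_add[of x "\<beta> - 4" 1]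
        by (simp_all add: X_def powr_numeral)
      have P: "P (1 + \<beta>) n = X * (x ^ 4 + (1 + \<beta>) * \<beta> / 2 * x ^ 3 + q (1 + \<beta>) * x\<^sup>2)"
        "P \<beta> n = X * (x ^ 3 + \<beta> * (\<beta> - 1) / 2 * x\<^sup>2 + q \<beta> * x)"
        "P (\<beta> - 1) n = X * (x\<^sup>2 + (\<beta> - 1) * (\<beta> - 2) / 2 * x + q (\<beta> - 1))"
        using x unfolding P_def x_def[symmetric]
        by (simp_all add: powrs) (simp_all add: field_simps power2_eq_square power3_eq_cube power4_eq_xxxx)
      have c: "\<beta> * (\<beta> - 1) * c = (1 + \<beta>) / 2 * \<beta>\<^sup>2 * (\<beta> - 1) / 2 - q (1 + \<beta>)"
        using assms by (simp add: c_def)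
      have main: "x powr \<beta> - P (1 + \<beta>) n + (1 + \<beta>) / 2 * \<beta> * P \<beta> n - c * (\<beta> * (\<beta> - 1)) * P (\<beta> - 1) n
            = k3 * x powr (\<beta> - 3) + k4 * X"
      proof -
        have "x powr \<beta> - P (1 + \<beta>) n + (1 + \<beta>) / 2 * \<beta> * P \<beta> n - c * (\<beta> * (\<beta> - 1)) * P (\<beta> - 1) n
            - (k3 * x powr (\<beta> - 3) + k4 * X) =
            X * x\<^sup>2 * ((1 + \<beta>) / 2 * \<beta>\<^sup>2 * (\<beta> - 1) / 2 - q (1 + \<beta>) - \<beta> * (\<beta> - 1) * c)"
          unfolding P powrs k3_def k4_def
          by (simp add: field_simps power2_eq_square power3_eq_cube power4_eq_xxxx)
        then show ?thesis using c by simp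
      qed
      have "- G * err (1 + \<beta>) n + G * (1 + \<beta>) / 2 * err \<beta> n - G * c * err (\<beta> - 1) n
         = - G * (rising_coeff (1 + \<beta>) n
      - (1 + \<beta>) / 2 * rising_coeff \<beta> n + c * rising_coeff (\<beta> - 1) n)
        + ((G * rGamma (1 + \<beta>)) * P (1 + \<beta>) n - (1 + \<beta>) / 2 * (G * rGamma \<beta>) * P \<beta> n + c * (G * rGamma (\<beta> - 1)) * P (\<beta> - 1) n)"
        by (simp add: err_def field_simps)
      then show ?case using main unfolding G1 G2 G3 X_def x_def by linarith
    qed
  qed simp
  finally show ?thesis using that unfolding G_def by blast
qed

text \<open>This is where the shift by \<alpha>/2 arises: the coefficient of order
  \<open>d - 1\<close> is
  \<open>(d + 1) * d / 2 - (1 + \<beta>) * d / 2 = - \<alpha> * d / 2\<close>, which matches the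
  expansion of \<open>(n - \<alpha> / 2) powr d\<close>.\<close>

lemma rising_coeff_combination_expansion:
  fixes \<alpha> \<beta> c :: real
  defines "d \<equiv> \<beta> - \<alpha>"
  shows "(\<lambda>n. rising_coeff (d + 1) n - (1 + \<beta>) / 2 * rising_coeff d n + c * rising_coeff (d - 1) n
            - rGamma (d + 1) * (real n - \<alpha> / 2) powr d) \<in> O(\<lambda>n. real n powr (d - 2))"
proof -
  have rG: "rGamma d = d * rGamma (d + 1)" by (simp add: rGamma_plus1)
  have 1: "(\<lambda>n. rising_coeff (d + 1) n - rGamma (d + 1) * (real n powr d * (1 + (d + 1) * d / 2 / real n)))
           \<in> O(\<lambda>n. real n powr (d - 2))"
    using rising_coeff_expansion_1[of "d + 1"] by (simp add: algebra_simps)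
  have 2: "(\<lambda>n. (1 + \<beta>) / 2 * (rising_coeff d n - rGamma d * real n powr (d - 1))) \<in> O(\<lambda>n. real n powr (d - 2))"
    using rising_coeff_expansion_0[of d] by simp
  have 3: "(\<lambda>n. c * rising_coeff (d - 1) n) \<in> O(\<lambda>n. real n powr (d - 2))"
    using rising_coeff_bigo[of "d - 1"] by simp
  have 4: "(\<lambda>n. rGamma (d + 1) * ((real n - \<alpha> / 2) powr d - real n powr d * (1 - \<alpha> * d / 2 / real n)))
          \<in> O(\<lambda>n. real n powr (d - 2))"
  proof -
    have "(\<lambda>n::nat. (real n - \<alpha> / 2) powr d - real n powr d * (1 - \<alpha> * d / 2 / real n)) \<in> O(\<lambda>n. real n powr (d - 2))"
      by real_asymp
    then show ?thesis by simp
  qed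
  have "(\<lambda>n. (rising_coeff (d + 1) n - rGamma (d + 1) * (real n powr d * (1 + (d + 1) * d / 2 / real n)))
     - (1 + \<beta>) / 2 * (rising_coeff d n - rGamma d * real n powr (d - 1)) + c * rising_coeff (d - 1) n
     - rGamma (d + 1) * ((real n - \<alpha> / 2) powr d - real n powr d * (1 - \<alpha> * d / 2 / real n))) \<in> O(\<lambda>n. real n powr (d - 2))"
    by (rule sum_in_bigo(2)[OF sum_in_bigo(1)[OF sum_in_bigo(2)[OF 1 2] 3] 4])
  also have "?this \<longleftrightarrow> ?thesis"
  proof (rule landau_o.big.cong_ex, goal_cases)
    case 1
    show ?case using eventually_gt_at_top[of 0]
    proof eventually_elim
      case (elim n)
      then have x: "real n powr (d - 1) = real n powr d / real n" by (subst powr_diff) simp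
      define y where "y = real n powr d / real n"
      have y: "real n powr d * (1 + (d + 1) * d / 2 / real n) = real n powr d + (d + 1) * d / 2 * y"
        "real n powr d * (1 - \<alpha> * d / 2 / real n) = real n powr d - \<alpha> * d / 2 * y"
        by (simp_all add: y_def algebra_simps)
      have b: "\<beta> = d + \<alpha>" by (simp add: d_def)
      show ?case unfolding x y rG y_def[symmetric] b by (simp add: field_simps)
    qed
  qed simp
  finally show ?thesis .
qed

text \<open>Summation raises each parameter by 1, and the resulting expansion has no constant term.
  The Euler-Maclaurin constant of the sums of \<open>m powr \<beta>\<close> is therefore carried by
  the remainder alone.\<close>

lemma sum_rising_coeff_combination_limit:
  fixes \<beta> c :: real
  assumes "0 < \<beta>" and "\<beta> < 1"
  shows "(\<lambda>n. Gamma (1 + \<beta>) * (\<Sum>m\<le>n. rising_coeff (1 + \<beta>) m - (1 + \<beta>) / 2 * rising_coeff \<beta> m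
           + c * rising_coeff (\<beta> - 1) m) - real n powr (1 + \<beta>) / (1 + \<beta>) - real n powr \<beta> / 2) \<longlonglongrightarrow> 0"
proof -
  define G where "G = Gamma (1 + \<beta>)"
  have "1 + \<beta> \<notin> \<int>\<^sub>\<le>\<^sub>0" using assms by (auto elim!: nonpos_Ints_cases)
  then have G1: "G * rGamma (1 + \<beta>) = 1" by (simp add: G_def Gamma_def rGamma_eq_zero_iff)
  have "G * rGamma (1 + \<beta>) = (1 + \<beta>) * (G * rGamma (2 + \<beta>))"
    using rGamma_plus1[of "1 + \<beta>", symmetric] by (simp add: add_ac)
  with G1 have G2: "G * rGamma (2 + \<beta>) = 1 / (1 + \<beta>)" using assms by (simp add: field_simps)
  have G0: "G \<noteq> 0" using G1 by auto
  have 1: "(\<lambda>n. rising_coeff (2 + \<beta>) n - rGamma (2 + \<beta>) * (real n powr (1 + \<beta>) * (1 + (2 + \<beta>) * (1 + \<beta>) / 2 / real n)))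
           \<in> O(\<lambda>n. real n powr (\<beta> - 1))"
    using rising_coeff_expansion_1[of "2 + \<beta>"] by (simp add: algebra_simps)
  have 2: "(\<lambda>n. (1 + \<beta>) / 2 * (rising_coeff (1 + \<beta>) n - rGamma (1 + \<beta>) * real n powr \<beta>)) \<in> O(\<lambda>n. real n powr (\<beta> - 1))"
    using rising_coeff_expansion_0[of "1 + \<beta>"] by simp
  have 3: "(\<lambda>n. c * rising_coeff \<beta> n) \<in> O(\<lambda>n. real n powr (\<beta> - 1))"
    using rising_coeff_bigo[of \<beta>] by simp
  have "(\<lambda>n. G * ((rising_coeff (2 + \<beta>) n - rGamma (2 + \<beta>) * (real n powr (1 + \<beta>) * (1 + (2 + \<beta>) * (1 + \<beta>) / 2 / real n)))
      - (1 + \<beta>) / 2 * (rising_coeff (1 + \<beta>) n - rGamma (1 + \<beta>) * real n powr \<beta>) + c * rising_coeff \<beta> n)) \<in> O(\<lambda>n. real n powr (\<beta> - 1))"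
    by (subst landau_o.big.cmult_in_iff[OF G0]) (rule sum_in_bigo(1)[OF sum_in_bigo(2)[OF 1 2] 3])
  also have "(\<lambda>n. real n powr (\<beta> - 1)) \<in> o(\<lambda>_. 1)"
    using assms by (intro smalloI_tendsto) (simp_all, real_asymp)
  finally have "(\<lambda>n. G * ((rising_coeff (2 + \<beta>) n - rGamma (2 + \<beta>) * (real n powr (1 + \<beta>) * (1 + (2 + \<beta>) * (1 + \<beta>) / 2 / real n)))
      - (1 + \<beta>) / 2 * (rising_coeff (1 + \<beta>) n - rGamma (1 + \<beta>) * real n powr \<beta>) + c * rising_coeff \<beta> n)) \<longlonglongrightarrow> 0"
    by (rule smalloD_tendsto[where g = "\<lambda>_. 1", unfolded div_by_1])
  moreover have "\<forall>\<^sub>F n in sequentially. G * ((rising_coeff (2 + \<beta>) n - rGamma (2 + \<beta>) * (real n powr (1 + \<beta>) * (1 + (2 + \<beta>) * (1 + \<beta>) / 2 / real n)))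
      - (1 + \<beta>) / 2 * (rising_coeff (1 + \<beta>) n - rGamma (1 + \<beta>) * real n powr \<beta>) + c * rising_coeff \<beta> n)
     = G * (\<Sum>m\<le>n. rising_coeff (1 + \<beta>) m - (1 + \<beta>) / 2 * rising_coeff \<beta> m
           + c * rising_coeff (\<beta> - 1) m) - real n powr (1 + \<beta>) / (1 + \<beta>) - real n powr \<beta> / 2"
    using eventually_gt_at_top[of 0]
  proof eventually_elim
    case (elim n)
    have x: "real n powr (1 + \<beta>) = real n powr \<beta> * real n" using elim powr_add[of "real n" 1 \<beta>] by simp
    have s: "(\<Sum>m\<le>n. rising_coeff (1 + \<beta>) m - (1 + \<beta>) / 2 * rising_coeff \<beta> m + c * rising_coeff (\<beta> - 1) m)
       = rising_coeff (2 + \<beta>) n - (1 + \<beta>) / 2 * rising_coeff (1 + \<beta>) n + c * rising_coeff \<beta> n"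
      unfolding sum.distrib sum_subtractf sum_distrib_left[symmetric] sum_rising_coeff by (simp add: add_ac)
    have "G * ((rising_coeff (2 + \<beta>) n - rGamma (2 + \<beta>) * (real n powr (1 + \<beta>) * (1 + (2 + \<beta>) * (1 + \<beta>) / 2 / real n)))
      - (1 + \<beta>) / 2 * (rising_coeff (1 + \<beta>) n - rGamma (1 + \<beta>) * real n powr \<beta>) + c * rising_coeff \<beta> n)
     = G * (rising_coeff (2 + \<beta>) n - (1 + \<beta>) / 2 * rising_coeff (1 + \<beta>) n + c * rising_coeff \<beta> n)
      - (G * rGamma (2 + \<beta>)) * (real n powr (1 + \<beta>) * (1 + (2 + \<beta>) * (1 + \<beta>) / 2 / real n))
      + (1 + \<beta>) / 2 * (G * rGamma (1 + \<beta>)) * real n powr \<beta>"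
      by (simp add: algebra_simps)
    also have "\<dots> = G * (rising_coeff (2 + \<beta>) n - (1 + \<beta>) / 2 * rising_coeff (1 + \<beta>) n + c * rising_coeff \<beta> n)
        - real n powr (1 + \<beta>) / (1 + \<beta>) - real n powr \<beta> / 2"
    proof -
      have "1 / b * (P * y * (1 + (1 + b) * b / 2 / y)) = P * y / b + (1 + b) / 2 * P" if "b > 0" "y > 0" for b y P :: real
        using that by (simp add: field_simps)
      from this[of "1 + \<beta>" "real n" "real n powr \<beta>"]
      have e: "1 / (1 + \<beta>) * (real n powr \<beta> * real n * (1 + (2 + \<beta>) * (1 + \<beta>) / 2 / real n))
          = real n powr \<beta> * real n / (1 + \<beta>) + (2 + \<beta>) / 2 * real n powr \<beta>"
        using elim assms by (simp add: add.assoc[symmetric])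
      define z where "z = real n powr \<beta> * real n / (1 + \<beta>)"
      show ?thesis
        unfolding G1 G2 x e z_def[symmetric] by (simp add: field_simps)
    qed
    finally show ?case unfolding s .
  qed
  ultimately show ?thesis unfolding G_def by (rule Lim_transform_eventually)
qed

text \<open>The constant \<open>R\<close> enters only as the total sum of the remainder
  \<open>r\<close>, so this part does not depend on its being a zeta value.\<close>

lemma fractional_difference_expansion:
  fixes \<alpha> \<beta> R :: real
  assumes "0 < \<alpha>" and "\<alpha> < 1" and "0 < \<beta>" and "\<beta> < 1"
    and R: "(\<lambda>n. (\<Sum>m\<le>n. real m powr \<beta>) - real n powr (1 + \<beta>) / (1 + \<beta>) - real n powr \<beta> / 2) \<longlonglongrightarrow> R"
  shows "(\<lambda>n. (\<Sum>k\<le>n. (-1) ^ k * (\<alpha> gchoose k) * real (n - k) powr \<beta>)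
           - (Gamma (1 + \<beta>) * rGamma (\<beta> - \<alpha> + 1) * (real n - \<alpha> / 2) powr (\<beta> - \<alpha>)
               + R * rGamma (-\<alpha>) * real n powr (-\<alpha>-1))) \<in> O(\<lambda>n. real n powr (\<beta> - \<alpha> - 2))"
proof -
  define G where "G = Gamma (1 + \<beta>)"
  define d where "d = \<beta> - \<alpha>"
  obtain c where c: "(\<lambda>n. real n powr \<beta> - G * (rising_coeff (1 + \<beta>) n
      - (1 + \<beta>) / 2 * rising_coeff \<beta> n + c * rising_coeff (\<beta> - 1) n)) \<in> O(\<lambda>n. real n powr (\<beta> - 3))"
    unfolding G_def using powr_rising_coeff_expansion[OF assms(3,4)] .
  define B where "B = (\<lambda>n. rising_coeff (1 + \<beta>) n
      - (1 + \<beta>) / 2 * rising_coeff \<beta> n + c * rising_coeff (\<beta> - 1) n)"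
  define r where "r = (\<lambda>n. real n powr \<beta> - G * B n)"
  define w where "w = rising_coeff (-\<alpha>)"
  have r: "r \<in> O(\<lambda>n. real n powr (-(3 - \<beta>)))" using c by (simp add: r_def B_def)
  have "summable r"
    by (rule summable_comparison_test_bigo[where g = "\<lambda>n. real n powr (-(3 - \<beta>))"])
       (use r assms in \<open>auto simp: summable_real_powr_iff\<close>)
  then have "(\<lambda>n. \<Sum>m\<le>n. r m) \<longlonglongrightarrow> suminf r" by (rule summable_LIMSEQ')
  moreover have "(\<lambda>n. \<Sum>m\<le>n. r m) \<longlonglongrightarrow> R - 0"
  proof -
    have "(\<lambda>n. ((\<Sum>m\<le>n. real m powr \<beta>) - real n powr (1 + \<beta>) / (1 + \<beta>) - real n powr \<beta> / 2)
         - (G * (\<Sum>m\<le>n. B m) - real n powr (1 + \<beta>) / (1 + \<beta>) - real n powr \<beta> / 2)) \<longlonglongrightarrow> R - 0"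
      unfolding G_def B_def
      by (intro tendsto_diff R sum_rising_coeff_combination_limit assms)
    then show ?thesis by (simp add: r_def sum_subtractf sum_distrib_left)
  qed
  ultimately have sum_r: "suminf r = R" using LIMSEQ_unique by fastforce
  have "(\<lambda>n. (\<Sum>k\<le>n. w k * r (n - k)) - w n * suminf r)
            \<in> O(\<lambda>n. real n powr (-\<alpha>-2) + real n powr (-(3-\<beta>)))"
  proof (rule convolution_expansion)
    show "w \<in> O(\<lambda>n. real n powr (-\<alpha>-1))" unfolding w_def by (rule rising_coeff_bigo)
    show "(\<lambda>n. w (Suc n) - w n) \<in> O(\<lambda>n. real n powr (-\<alpha>-2))" unfolding w_def by (rule rising_coeff_diff_bigo)
  qed (use r assms in auto)
  \<comment> \<open>The first exponent is admissible because \<beta> is positive, the second because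
    \<alpha> is below 1.\<close>
  also have "(\<lambda>n. real n powr (-\<alpha>-2) + real n powr (-(3-\<beta>))) \<in> O(\<lambda>n. real n powr (d - 2))"
    by (intro sum_in_bigo powr_bigo_mono) (use assms in \<open>auto simp: d_def\<close>)
  finally have 1: "(\<lambda>n. (\<Sum>k\<le>n. w k * r (n - k)) - w n * R) \<in> O(\<lambda>n. real n powr (d - 2))"
    by (simp only: sum_r)
  have 2: "(\<lambda>n. R * (w n - rGamma (-\<alpha>) * real n powr (-\<alpha>-1))) \<in> O(\<lambda>n. real n powr (d - 2))"
  proof -
    have "(\<lambda>n. w n - rGamma (-\<alpha>) * real n powr (-\<alpha>-1)) \<in> O(\<lambda>n. real n powr (d - 2))"
      unfolding w_def
      by (rule landau_o.big_trans[OF rising_coeff_expansion_0 powr_bigo_mono]) (use assms in \<open>simp add: d_def\<close>)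
    then show ?thesis by simp
  qed
  have 3: "(\<lambda>n. G * (rising_coeff (d + 1) n - (1 + \<beta>) / 2 * rising_coeff d n + c * rising_coeff (d - 1) n
            - rGamma (d + 1) * (real n - \<alpha> / 2) powr d)) \<in> O(\<lambda>n. real n powr (d - 2))"
    using rising_coeff_combination_expansion[of \<beta> \<alpha> c] by (simp add: d_def)
  have conv: "(\<Sum>k\<le>n. w k * B (n - k)) = rising_coeff (d + 1) n - (1 + \<beta>) / 2 * rising_coeff d n + c * rising_coeff (d - 1) n" for n
  proof -
    have "(\<Sum>k\<le>n. w k * B (n - k)) = (\<Sum>k\<le>n. w k * rising_coeff (1 + \<beta>) (n - k))
       - (1 + \<beta>) / 2 * (\<Sum>k\<le>n. w k * rising_coeff \<beta> (n - k)) + c * (\<Sum>k\<le>n. w k * rising_coeff (\<beta> - 1) (n - k))"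
      by (simp add: B_def sum_distrib_left sum_subtractf[symmetric] sum.distrib[symmetric] algebra_simps)
    also have "\<dots> = rising_coeff (-\<alpha> + (1 + \<beta>)) n - (1 + \<beta>) / 2 * rising_coeff (-\<alpha> + \<beta>) n + c * rising_coeff (-\<alpha> + (\<beta> - 1)) n"
      by (simp only: w_def rising_coeff_convolution)
    finally show ?thesis by (simp add: d_def algebra_simps)
  qed
  have split: "(\<Sum>k\<le>n. (-1) ^ k * (\<alpha> gchoose k) * real (n - k) powr \<beta>) = (\<Sum>k\<le>n. w k * r (n - k)) + G * (\<Sum>k\<le>n. w k * B (n - k))" for n
  proof -
    have "(-1) ^ k * (\<alpha> gchoose k) = w k" for k
      by (simp add: w_def rising_coeff_def gbinomial_pochhammer flip: power_mult_distrib)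
    then show ?thesis by (simp add: r_def sum_distrib_left sum.distrib[symmetric] algebra_simps)
  qed
  have "(\<lambda>n. ((\<Sum>k\<le>n. w k * r (n - k)) - w n * R) + R * (w n - rGamma (-\<alpha>) * real n powr (-\<alpha>-1))
     + G * (rising_coeff (d + 1) n - (1 + \<beta>) / 2 * rising_coeff d n + c * rising_coeff (d - 1) n
            - rGamma (d + 1) * (real n - \<alpha> / 2) powr d)) \<in> O(\<lambda>n. real n powr (d - 2))"
    by (rule sum_in_bigo(1)[OF sum_in_bigo(1)[OF 1 2] 3])
  then show ?thesis
    unfolding split conv by (simp add: G_def[symmetric] d_def[symmetric] algebra_simps)
qed

text \<open>Substituting \<open>t = n * h\<close> pulls the factor
  \<open>h powr (\<beta> - \<alpha>)\<close> out of every term, which leaves the expansion in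
  \<open>n\<close>.\<close>

theorem mainTheorem11:
  fixes \<alpha> \<beta> t :: real
  assumes "0 < \<alpha>" and "\<alpha> < 1"
    and "0 < \<beta>" and "\<beta> < 1"
    and "0 < t"
  shows "(\<lambda>n::nat. let h = t / real n in
            1 / h powr \<alpha> * (\<Sum>k=0..n. (-1) ^ k * (\<alpha> gchoose k) * (t - real k * h) powr \<beta>)
            - (Gamma (\<beta> + 1) / Gamma (\<beta> - \<alpha> + 1) * (t - \<alpha> * h / 2) powr (\<beta> - \<alpha>)
               + Re (riemann_zeta (of_real (- \<beta>))) / (Gamma (- \<alpha>) * t powr (\<alpha> + 1))
                 * h powr (\<beta> + 1)))
         \<in> O(\<lambda>n. (t / real n)\<^sup>2)"
proof -
  define R where "R = Re (riemann_zeta (of_real (-\<beta>)))"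
  define D where "D = (\<lambda>n. (\<Sum>k\<le>n. (-1) ^ k * (\<alpha> gchoose k) * real (n - k) powr \<beta>)
           - (Gamma (1 + \<beta>) * rGamma (\<beta> - \<alpha> + 1) * (real n - \<alpha> / 2) powr (\<beta> - \<alpha>)
               + R * rGamma (-\<alpha>) * real n powr (-\<alpha>-1)))"
  have "D \<in> O(\<lambda>n. real n powr (\<beta> - \<alpha> - 2))"
    unfolding D_def R_def
    by (intro fractional_difference_expansion riemann_zeta_neg_limit assms)
  then have "(\<lambda>n. (t / real n) powr (\<beta> - \<alpha>) * D n) \<in> O(\<lambda>n. (t / real n) powr (\<beta> - \<alpha>) * real n powr (\<beta> - \<alpha> - 2))"
    by (intro landau_o.big.mult) auto
  also have "(\<lambda>n. (t / real n) powr (\<beta> - \<alpha>) * real n powr (\<beta> - \<alpha> - 2)) \<in> O(\<lambda>n. (t / real n)\<^sup>2)"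
  proof (rule bigoI)
    \<comment> \<open>The powers of \<open>n\<close> combine to \<open>n^(-2)\<close>, so for
      positive \<open>n\<close> this is an equality.\<close>
    show "\<forall>\<^sub>F n in sequentially. norm ((t / real n) powr (\<beta> - \<alpha>) * real n powr (\<beta> - \<alpha> - 2))
            \<le> t powr (\<beta> - \<alpha> - 2) * norm ((t / real n)\<^sup>2)"
      using eventually_gt_at_top[of 0]
    proof eventually_elim
      case (elim n)
      have "x powr (\<beta> - \<alpha> - 2) = x powr (\<beta> - \<alpha>) / x\<^sup>2" if "x > 0" for x :: real
        using that powr_diff[of x "\<beta> - \<alpha>" 2] by (simp add: powr_numeral)
      with elim show ?case using assms(5)
        by (simp add: powr_divide power_divide)
    qed
  qed
  finally have main: "(\<lambda>n. (t / real n) powr (\<beta> - \<alpha>) * D n) \<in> O(\<lambda>n. (t / real n)\<^sup>2)" .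
  have "\<forall>\<^sub>F n in sequentially. (t / real n) powr (\<beta> - \<alpha>) * D n =
      (let h = t / real n in
            1 / h powr \<alpha> * (\<Sum>k=0..n. (-1) ^ k * (\<alpha> gchoose k) * (t - real k * h) powr \<beta>)
            - (Gamma (\<beta> + 1) / Gamma (\<beta> - \<alpha> + 1) * (t - \<alpha> * h / 2) powr (\<beta> - \<alpha>)
               + Re (riemann_zeta (of_real (- \<beta>))) / (Gamma (- \<alpha>) * t powr (\<alpha> + 1))
                 * h powr (\<beta> + 1)))"
    using eventually_gt_at_top[of 0]
  proof eventually_elim
    case (elim n)
    define h where "h = t / real n"
    have h: "h > 0" "t = h * real n" using elim assms(5) by (simp_all add: h_def)
    have S: "(\<Sum>k=0..n. (-1) ^ k * (\<alpha> gchoose k) * (t - real k * h) powr \<beta>)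
        = h powr \<beta> * (\<Sum>k\<le>n. (-1) ^ k * (\<alpha> gchoose k) * real (n - k) powr \<beta>)"
      unfolding sum_distrib_left atLeast0AtMost
    proof (rule sum.cong)
      fix k assume "k \<in> {..n}"
      then have "t - real k * h = h * real (n - k)" by (simp add: h(2) of_nat_diff algebra_simps)
      then have "(t - real k * h) powr \<beta> = h powr \<beta> * real (n - k) powr \<beta>"
        using h by (simp add: powr_mult)
      then show "(-1) ^ k * (\<alpha> gchoose k) * (t - real k * h) powr \<beta> = h powr \<beta> * ((-1) ^ k * (\<alpha> gchoose k) * real (n - k) powr \<beta>)"
        by simp
    qed simp
    have A: "(t - \<alpha> * h / 2) powr (\<beta> - \<alpha>) = h powr (\<beta> - \<alpha>) * (real n - \<alpha> / 2) powr (\<beta> - \<alpha>)"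
    proof -
      have "t - \<alpha> * h / 2 = h * (real n - \<alpha> / 2)" by (simp add: h(2) algebra_simps)
      moreover have "real n - \<alpha> / 2 \<ge> 0" using elim assms(2) by linarith
      ultimately show ?thesis using h by (simp add: powr_mult)
    qed
    have Z: "h powr (\<beta> + 1) / t powr (\<alpha> + 1) = h powr (\<beta> - \<alpha>) * real n powr (-\<alpha>-1)"
    proof -
      have "t powr (\<alpha> + 1) = h powr (\<alpha> + 1) * real n powr (\<alpha> + 1)"
        unfolding h(2) by (rule powr_mult)
      moreover have "h powr (\<beta> + 1) = h powr (\<beta> - \<alpha>) * h powr (\<alpha> + 1)"
        by (simp flip: powr_add)
      moreover have "real n powr (-\<alpha>-1) = 1 / real n powr (\<alpha> + 1)"
        using powr_minus_divide[of "real n" "\<alpha> + 1"] by simp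
      ultimately show ?thesis using h by simp
    qed
    have c1: "1 / h powr \<alpha> * (h powr \<beta> * s) = h powr (\<beta> - \<alpha>) * s" for s
      by (simp add: powr_diff)
    have c2: "Gamma (\<beta> + 1) / Gamma (\<beta> - \<alpha> + 1) = Gamma (1 + \<beta>) * rGamma (\<beta> - \<alpha> + 1)"
      by (simp add: rGamma_inverse_Gamma divide_inverse add.commute)
    have "R / (Gamma (-\<alpha>) * t powr (\<alpha> + 1)) * h powr (\<beta> + 1)
        = R * rGamma (-\<alpha>) * (h powr (\<beta> + 1) / t powr (\<alpha> + 1))"
      by (simp add: rGamma_inverse_Gamma field_simps)
    then have c3: "R / (Gamma (-\<alpha>) * t powr (\<alpha> + 1)) * h powr (\<beta> + 1)
        = R * rGamma (-\<alpha>) * (h powr (\<beta> - \<alpha>) * real n powr (-\<alpha>-1))"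
      unfolding Z .
    show ?case
      unfolding Let_def h_def[symmetric] R_def[symmetric] S A c1 c2 c3 D_def
      by (simp only: ring_distribs mult_ac)
  qed
  from landau_o.big.in_cong[OF this] main show ?thesis by blast
qed

end
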